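(* Let $m\in\mathbb{Z}_+=\{0,1,2,\dots\}$, $q\in\,]0,1[$ and $z,w\in\mathbb{C}_{q,m}$. Then $$\langle z,m,q|w,m,q\rangle=\frac{q^{-m}\,(q^{-m+1}(1-q)z\bar z;q)_\infty}{(q^{-m}(1-q)w\bar z;q)_\infty\,(q(1-q)z\bar z;q)_\infty}\cdot\frac{\left(\tfrac{\bar w}{\bar z}\,q;q\right)_m}{(q;q)_m}\;{}_3\phi_2\!\left(\begin{array}{c}q^{-m},\ q^{-m}(1-q)w\bar z,\ \tfrac{\bar w}{\bar z}\\[2pt] q^{-m+1}(1-q)z\bar z,\ \tfrac{\bar z}{\bar w}\,q^{-m}\end{array}\Big|\,q;q\right),$$ where $\langle z,m,q|w,m,q\rangle$ denotes the overlap of the coherent states labelled by $z$ and $w$, taken without their normalization factors.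
   Context: Notation: $(a;q)_n=\prod_{k=0}^{n-1}(1-aq^k)$ for $n\in\{0,1,\dots\}\cup\{\infty\}$; $m\wedge j=\min(m,j)$, $m\vee j=\max(m,j)$. Basic hypergeometric series: $(a_1,\dots,a_r;q)_k=\prod_i(a_i;q)_k$, ${}_2\phi_1(a,b;c\,|\,q;x)=\sum_{k\ge0}\frac{(a,b;q)_k}{(c,q;q)_k}x^k$, and ${}_3\phi_2\big(\begin{smallmatrix}a,b,c\\ d,e\end{smallmatrix}\big|q;x\big)=\sum_{k\ge0}\frac{(a,b,c;q)_k}{(d,e,q;q)_k}x^k$. With $a=q^{-m}$ the latter sum runs over $0\le k\le m$. Wall polynomials: $P_n(x;a|q)={}_2\phi_1(q^{-n},0;aq\,|\,q;qx)$. Coefficients: for $m,j\in\mathbb{Z}_+$ and $z\in\mathbb{C}$ with $\theta=\arg z$, $$h_j^{m,q}(z)=\frac{(-1)^{m\wedge j}(q;q)_{m\vee j}\,q^{\binom{m\wedge j}{2}}(\sqrt{1-q})^{|m-j|}|z|^{|m-j|}e^{-i(m-j)\theta}}{(q;q)_{|m-j|}\sqrt{q^{mj}(q;q)_m(q;q)_j}}\,P_{m\wedge j}\big((1-q)z\bar z;q^{|m-j|}\big|q\big).$$ Domain: $\mathbb{C}_{q,m}=\{z\in\mathbb{C}:(1-q)z\bar z<q^m\}$. Continuous $q$-Hermite polynomials: $H_n(\cos\theta|q)=\sum_{k=0}^n\frac{(q;q)_n}{(q;q)_k(q;q)_{n-k}}e^{i(n-2k)\theta}$. Weight: $\omega_q(u)=\dfrac{(q;q)_\infty\sqrt{1-q}}{4\pi\sqrt{1-(1-q)u^2/4}}\prod_{k\ge0}\big(1+(2-u^2(1-q))q^k+q^{2k}\big)$.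 The functions $\varphi_j^q(\xi)=\sqrt{\frac{\sqrt2\,\omega_q(\sqrt2\,\xi)}{(q;q)_j}}\,H_j\!\left(\sqrt{\tfrac{1-q}{2}}\,\xi\,\big|\,q\right)$, $j\ge0$, are orthonormal in $L^2(\mathcal{I}_q,d\xi)$, $\mathcal{I}_q=\left(-\frac{\sqrt2}{\sqrt{1-q}},\frac{\sqrt2}{\sqrt{1-q}}\right)$. Coherent states: $|z,m,q\rangle=(\mathcal{N}_{m,q}(z\bar z))^{-1/2}\sum_{j\ge0}\overline{h_j^{m,q}(z)}\,|\varphi_j^q\rangle$, where $\mathcal{N}_{m,q}(z\bar z)=\dfrac{q^{-m}(q^{1-m}(1-q)z\bar z;q)_m}{(q^{-m}(1-q)z\bar z;q)_\infty}$ is the normalization factor. In the formula the overlap is that of the sums $\sum_{j\ge0}\overline{h_j^{m,q}(z)}\,\varphi_j^q$ and $\sum_{j\ge0}\overline{h_j^{m,q}(w)}\,\varphi_j^q$, with an inner product linear in its first argument, that is, $\sum_{j\ge0}\overline{h_j^{m,q}(z)}\,h_j^{m,q}(w)$. Setting $z=w$ gives $\mathcal{N}_{m,q}(z\bar z)$.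
   Formalization: The third upper parameter of the 3φ2 is corrected to z̄/w̄ (the printed w̄/z̄ fails for m=1, being unbounded as z→0); where the right side is undefined (z=0, w=0, or z̄/w̄=q^i with 1≤i≤m) it is read as its limit. *)

theory Defs
  imports "HOL-Analysis.Analysis"
begin

definition qpoch :: "'a::comm_ring_1 \<Rightarrow> 'a \<Rightarrow> nat \<Rightarrow> 'a" where
  "qpoch a q n = (\<Prod>k<n. 1 - a * q ^ k)"

definition qpoch_inf :: "'a::real_normed_field \<Rightarrow> 'a \<Rightarrow> 'a" where
  "qpoch_inf a q = (\<Prod>k. 1 - a * q ^ k)"

text \<open>If an upper parameter is \<open>q\<^bsup>-n\<^esup>\<close>, all terms with index \<open>k > n\<close> vanish
  (also where a lower factor vanishes, since \<open>x / 0 = 0\<close>), so these series then are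
  the finite sums over \<open>k \<le> n\<close>.\<close>

definition phi21 :: "'a::real_normed_field \<Rightarrow> 'a \<Rightarrow> 'a \<Rightarrow> 'a \<Rightarrow> 'a \<Rightarrow> 'a" where
  "phi21 a b c q x =
     (\<Sum>k. (qpoch a q k * qpoch b q k) / (qpoch c q k * qpoch q q k) * x ^ k)"

definition phi32 :: "'a::real_normed_field \<Rightarrow> 'a \<Rightarrow> 'a \<Rightarrow> 'a \<Rightarrow> 'a \<Rightarrow> 'a \<Rightarrow> 'a \<Rightarrow> 'a" where
  "phi32 a b c d e q x =
     (\<Sum>k. (qpoch a q k * qpoch b q k * qpoch c q k)
          / (qpoch d q k * qpoch e q k * qpoch q q k) * x ^ k)"

definition wall_poly :: "nat \<Rightarrow> real \<Rightarrow> real \<Rightarrow> real \<Rightarrow> real" where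
  "wall_poly n x a q = phi21 (q powi (- int n)) 0 (a * q) q (q * x)"

text \<open>Below, \<open>max m j - min m j\<close> is \<open>\<bar>m - j\<bar>\<close>.\<close>

definition h_coeff :: "nat \<Rightarrow> real \<Rightarrow> nat \<Rightarrow> complex \<Rightarrow> complex" where
  "h_coeff m q j z =
     (let d = max m j - min m j in
      complex_of_real
        (((-1) ^ min m j * qpoch q q (max m j) * q ^ (min m j choose 2) * sqrt (1 - q) ^ d * cmod z ^ d)
         / (qpoch q q d * sqrt (q ^ (m * j) * qpoch q q m * qpoch q q j)))
      * cis (- (real m - real j) * Arg z)
      * complex_of_real (wall_poly (min m j) ((1 - q) * (cmod z)\<^sup>2) (q ^ d) q))"

definition coherent_domain :: "real \<Rightarrow> nat \<Rightarrow> complex set" where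
  "coherent_domain q m = {z. (1 - q) * (cmod z)\<^sup>2 < q ^ m}"

text \<open>Continuous \<open>q\<close>-Hermite polynomials as functions of \<open>x = cos \<theta> \<in> [-1, 1]\<close>;
  the values are real numbers, kept here in the complex type.\<close>

definition q_hermite :: "real \<Rightarrow> nat \<Rightarrow> real \<Rightarrow> complex" where
  "q_hermite q n x =
     (\<Sum>k\<le>n. complex_of_real (qpoch q q n / (qpoch q q k * qpoch q q (n - k)))
            * cis ((real n - 2 * real k) * arccos x))"

definition q_weight :: "real \<Rightarrow> real \<Rightarrow> real" where
  "q_weight q u =
     (qpoch_inf q q * sqrt (1 - q)) / (4 * pi * sqrt (1 - (1 - q) * u\<^sup>2 / 4))
     * (\<Prod>k. 1 + (2 - u\<^sup>2 * (1 - q)) * q ^ k + q ^ (2 * k))"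

definition q_interval :: "real \<Rightarrow> real set" where
  "q_interval q = {- (sqrt 2 / sqrt (1 - q)) <..< sqrt 2 / sqrt (1 - q)}"

definition q_fun :: "real \<Rightarrow> nat \<Rightarrow> real \<Rightarrow> complex" where
  "q_fun q j \<xi> =
     complex_of_real (sqrt (sqrt 2 * q_weight q (sqrt 2 * \<xi>) / qpoch q q j))
     * q_hermite q j (sqrt ((1 - q) / 2) * \<xi>)"

definition has_L2_sum :: "real set \<Rightarrow> (nat \<Rightarrow> real \<Rightarrow> complex) \<Rightarrow> (real \<Rightarrow> complex) \<Rightarrow> bool" where
  "has_L2_sum I f g \<longleftrightarrow>
     set_borel_measurable lborel I g \<and>
     (\<forall>n. set_integrable lborel I (\<lambda>\<xi>. (cmod (g \<xi> - (\<Sum>j<n. f j \<xi>)))\<^sup>2)) \<and>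
     (\<lambda>n. LBINT \<xi>:I. (cmod (g \<xi> - (\<Sum>j<n. f j \<xi>)))\<^sup>2) \<longlonglongrightarrow> 0"

text \<open>The coherent state without its normalization factor, as a function on
  \<open>q_interval q\<close>. For \<open>z \<in> coherent_domain q m\<close> the series converges there pointwise
  as well as in the \<open>L\<^sup>2\<close> sense, with the same sum.\<close>

definition coherent_state :: "nat \<Rightarrow> real \<Rightarrow> complex \<Rightarrow> real \<Rightarrow> complex" where
  "coherent_state m q z \<xi> = (\<Sum>j. cnj (h_coeff m q j z) * q_fun q j \<xi>)"

definition overlap :: "nat \<Rightarrow> real \<Rightarrow> complex \<Rightarrow> complex \<Rightarrow> complex" where
  "overlap m q z w =
     (LBINT \<xi>:q_interval q. coherent_state m q z \<xi> * cnj (coherent_state m q w \<xi>))"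

text \<open>The third upper parameter of the \<open>\<^sub>3\<phi>\<^sub>2\<close> is \<open>cnj z / cnj w\<close>. With the reciprocal
  \<open>cnj w / cnj z\<close> in its place the expression is not the overlap: for \<open>m = 1\<close> it is
  unbounded as \<open>z\<close> tends to \<open>0\<close>.\<close>

definition overlap_formula :: "nat \<Rightarrow> real \<Rightarrow> complex \<Rightarrow> complex \<Rightarrow> complex" where
  "overlap_formula m q z w =
     (let Q = complex_of_real q in
      (Q powi (- int m) * qpoch_inf (Q powi (- int m + 1) * (1 - Q) * (z * cnj z)) Q)
      / (qpoch_inf (Q powi (- int m) * (1 - Q) * (w * cnj z)) Q
         * qpoch_inf (Q * (1 - Q) * (z * cnj z)) Q)
      * (qpoch (cnj w / cnj z * Q) Q m / qpoch Q Q m)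
      * phi32 (Q powi (- int m)) (Q powi (- int m) * (1 - Q) * (w * cnj z)) (cnj z / cnj w)
              (Q powi (- int m + 1) * (1 - Q) * (z * cnj z)) (cnj z / cnj w * Q powi (- int m))
              Q Q)"

text \<open>The pairs of labels for which no denominator in \<open>overlap_formula\<close> vanishes.
  The exceptional pairs (\<open>z = 0\<close>, \<open>w = 0\<close>, or \<open>cnj z / cnj w = q\<^sup>i\<close> with
  \<open>1 \<le> i \<le> m\<close>) are removable singularities.\<close>

definition regular_pairs :: "nat \<Rightarrow> real \<Rightarrow> (complex \<times> complex) set" where
  "regular_pairs m q =
     {(z, w). z \<in> coherent_domain q m \<and> w \<in> coherent_domain q m \<and> z \<noteq> 0 \<and> w \<noteq> 0 \<and>
        qpoch (cnj z / cnj w * complex_of_real q powi (- int m)) (complex_of_real q) m \<noteq> 0}"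

end

theory Submission
  imports Defs
begin

text \<open>Write \<open>(a)\<^sub>n\<close> for \<open>(a; q)\<^sub>n\<close>, \<open>t = sqrt (1 - q) * z\<close> and \<open>s = sqrt (1 - q) * w\<close>.

\<^emph>\<open>The closed form.\<close> Reversing the order of summation in the Wall polynomial turns \<open>h_coeff m q j z\<close> into
\<open>sqrt ((q)\<^sub>m (q)\<^sub>j / q^(m j))\<close> times a polynomial in \<open>t\<close> and \<open>cnj t\<close>, a \<open>q\<close>-analogue of the complex Hermite (Ito)
polynomials, and the cases \<open>j \<le> m\<close> and \<open>m \<le> j\<close> become one formula (\<open>h_coeff_eq_ito_poly\<close>). Two facts about these
polynomials give the sum over \<open>j\<close>. First, \<open>u^m\<close> times the polynomial in \<open>(u, v)\<close> is, up to the factor \<open>(q)\<^sub>m (q)\<^sub>j\<close>, the product of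
\<open>u^j\<close> and a polynomial in \<open>u v\<close> and \<open>q^j\<close> that is symmetric in these two, so it can be expanded in the powers of \<open>q^j\<close>
with coefficients \<open>\<Prod>a<n. u v - q^a\<close> (\<open>ito_poly_power_expansion\<close>). Secondly, the generating function over \<open>j\<close>
is a finite product divided by an infinite one, by Euler's series and Gauss's \<open>q\<close>-binomial theorem
(\<open>ito_poly_generating_function\<close>). Using the first fact for the factor with \<open>z\<close> and the second for the factor with \<open>w\<close>
leaves a sum over \<open>n \<le> m\<close>, whose \<open>n\<close>-th summand is the summand with index \<open>k = m - n\<close> of the \<open>\<^sub>3\<phi>\<^sub>2\<close>
(\<open>phi32_summand_eq\<close>).

\<^emph>\<open>The overlap is this series.\<close> The substitution \<open>\<xi> = sqrt (2 / (1 - q)) * cos \<theta>\<close> turns the inner products of the functions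
\<open>q_fun\<close> into integrals of \<open>H\<^sub>j H\<^sub>k\<close> against \<open>(e^(2 i \<theta>))\<^sub>\<infinity> (e^(-2 i \<theta>))\<^sub>\<infinity>\<close>. The truncated weights are Laurent polynomials
given by the finite form of Jacobi's triple product, so their Fourier coefficients are explicit, and they converge
(\<open>theta_weight_moment\<close>). Orthogonality is then the vanishing of sums evaluated by the \<open>q\<close>-binomial theorem. Since
\<open>h_coeff m q j z\<close> decays geometrically in \<open>j\<close>, locally uniformly in \<open>z\<close>, while \<open>q_fun q j\<close> is bounded by a multiple of
\<open>j + 1\<close>, the series of the coherent state converges uniformly; this gives the convergence in \<open>L\<^sup>2\<close>, the series
for the overlap, and the continuity of the overlap in \<open>(z, w)\<close>, which settles the removable singularities.\<close>

section \<open>Finite and infinite \<open>q\<close>-shifted factorials\<close>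

lemma qpoch_0 [simp]: "qpoch a q 0 = 1"
  by (simp add: qpoch_def)

lemma qpoch_Suc: "qpoch a q (Suc n) = qpoch a q n * (1 - a * q ^ n)"
  by (simp add: qpoch_def)

lemma qpoch_add: "qpoch a q (m + n) = qpoch a q m * qpoch (a * q ^ m) q n"
  by (induction n) (simp_all add: qpoch_Suc power_add mult.assoc)

lemma qpoch_of_real: "qpoch (complex_of_real a) (complex_of_real q) n = complex_of_real (qpoch a q n)"
  by (simp add: qpoch_def)

lemma qpoch_pos: "qpoch q q n > 0" if "0 < q" "q < 1" for q :: real
proof -
  have "q * q ^ k < 1" for k
    using that power_strict_decreasing[of 0 "Suc k" q] by simp
  then show ?thesis by (auto simp: qpoch_def intro!: prod_pos)
qed

lemma qpoch_le_1: "qpoch q q n \<le> 1" if "0 < q" "q < 1" for q :: real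
  unfolding qpoch_def
proof (intro prod_le_1 conjI)
  fix k
  have "q * q ^ k \<le> 1" using that power_le_one[of q "Suc k"] by simp
  then show "0 \<le> 1 - q * q ^ k" "1 - q * q ^ k \<le> 1" using that by auto
qed

text \<open>The recursion avoids division, so that the \<open>q\<close>-binomial theorem holds in every commutative ring; the quotient of
\<open>q\<close>-shifted factorials is recovered in \<open>qbinom_mult_qpoch\<close>. For \<open>k > n\<close> the truncated exponent \<open>n - k\<close> is harmless,
as it multiplies a coefficient that vanishes.\<close>

fun qbinom :: "'a::comm_ring_1 \<Rightarrow> nat \<Rightarrow> nat \<Rightarrow> 'a" where
  "qbinom q n 0 = 1"
| "qbinom q 0 (Suc k) = 0"
| "qbinom q (Suc n) (Suc k) = qbinom q n (Suc k) + q ^ (n - k) * qbinom q n k"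

lemma qbinom_eq_0: "n < k \<Longrightarrow> qbinom q n k = 0"
  by (induction q n k rule: qbinom.induct) auto

lemma qbinom_self [simp]: "qbinom q n n = 1"
  by (induction n) (auto simp: qbinom_eq_0)

lemma qbinom_mult_qpoch:
  "k \<le> n \<Longrightarrow> qbinom q n k * (qpoch q q k * qpoch q q (n - k)) = qpoch q q n"
proof (induction q n k rule: qbinom.induct)
  case (3 q n k)
  show ?case
  proof (cases "k = n")
    case False
    with 3 have k: "k < n" by simp
    define r where "r = n - Suc k"
    have r: "n - k = Suc r" "n = Suc (k + r)" "n - Suc k = r" using k by (auto simp: r_def)
    have 1: "qbinom q n (Suc k) * (qpoch q q (Suc k) * qpoch q q r) = qpoch q q n"
      using 3(1) k r by simp
    have 2: "qbinom q n k * (qpoch q q k * qpoch q q (Suc r)) = qpoch q q n"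
      using 3(2) k r by simp
    have "qbinom q (Suc n) (Suc k) * (qpoch q q (Suc k) * qpoch q q (Suc n - Suc k))
      = (qbinom q n (Suc k) * (qpoch q q (Suc k) * qpoch q q r)) * (1 - q ^ Suc r)
        + q ^ Suc r * (1 - q ^ Suc k) * (qbinom q n k * (qpoch q q k * qpoch q q (Suc r)))"
      by (simp add: r(1) qpoch_Suc algebra_simps)
    also have "\<dots> = qpoch q q n * (1 - q * q ^ n)"
      unfolding 1 2 by (simp add: r(2) power_add algebra_simps)
    finally show ?thesis by (simp add: qpoch_Suc)
  qed (auto simp: qbinom_eq_0)
qed auto

lemma qbinom_eq_divide:
  fixes q :: "'a::field"
  assumes "\<And>n. qpoch q q n \<noteq> 0" "k \<le> n"
  shows "qbinom q n k = qpoch q q n / (qpoch q q k * qpoch q q (n - k))"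
  using qbinom_mult_qpoch[OF assms(2), of q] assms(1) by (simp add: field_simps)

text \<open>Gauss's \<open>q\<close>-binomial theorem, in a homogeneous form that also covers \<open>y = 0\<close>. The induction multiplies by the factor
\<open>y - x q^n\<close> and compares coefficients with the recursion of \<open>qbinom\<close>.\<close>

lemma gauss_q_binomial:
  "(\<Sum>k\<le>n. qbinom q n k * (-1) ^ k * q ^ (k choose 2) * x ^ k * y ^ (n - k)) = (\<Prod>i<n. y - x * q ^ i)"
proof (induction n)
  case (Suc n)
  define a where "a n k = qbinom q n k * (-1) ^ k * q ^ (k choose 2) * x ^ k * y ^ (n - k)" for n k
  have s: "a (Suc n) (Suc k) = y * a n (Suc k) - x * q ^ n * a n k" if "k \<le> n" for k
  proof -
    have c: "Suc k choose 2 = k + (k choose 2)" by (simp add: numeral_2_eq_2)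
    have q: "q ^ n = q ^ (n - k) * q ^ k" using that by (simp flip: power_add)
    have y: "y ^ (n - k) * qbinom q n (Suc k) = y * y ^ (n - Suc k) * qbinom q n (Suc k)"
      using that by (cases "k = n") (auto simp: qbinom_eq_0 Suc_diff_Suc simp flip: power_Suc)
    have "a (Suc n) (Suc k) = (y ^ (n - k) * qbinom q n (Suc k)) * (-1) ^ Suc k * q ^ (Suc k choose 2) * x ^ Suc k
         + q ^ (n - k) * qbinom q n k * (-1) ^ Suc k * q ^ (Suc k choose 2) * x ^ Suc k * y ^ (n - k)"
      by (simp add: a_def algebra_simps)
    also have "\<dots> = y * a n (Suc k) - x * q ^ n * a n k"
      unfolding y by (simp add: a_def c q power_add algebra_simps)
    finally show ?thesis .
  qed
  have "(\<Sum>k\<le>Suc n. a (Suc n) k) = a (Suc n) 0 + (\<Sum>k\<le>n. y * a n (Suc k) - x * q ^ n * a n k)"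
    using s by (simp add: sum.atMost_Suc_shift del: sum.atMost_Suc)
  also have "\<dots> = y * (\<Sum>k\<le>Suc n. a n k) - x * q ^ n * (\<Sum>k\<le>n. a n k)"
    by (simp add: sum.atMost_Suc_shift sum_subtractf sum_distrib_left a_def algebra_simps del: sum.atMost_Suc)
  also have "(\<Sum>k\<le>Suc n. a n k) = (\<Sum>k\<le>n. a n k)"
    by (simp add: a_def qbinom_eq_0)
  finally show ?case using Suc by (simp add: a_def algebra_simps)
qed (simp add: numeral_2_eq_2)

lemma qpoch_tendsto_qpoch_inf:
  fixes q :: "'a::{real_normed_field,banach}"
  assumes "norm q < 1"
  shows "qpoch a q \<longlonglongrightarrow> qpoch_inf a q"
    and "convergent_prod (\<lambda>k. 1 - a * q ^ k)"
proof -
  have "summable (\<lambda>k. norm (- (a * q ^ k)))"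
    using assms by (simp add: norm_mult norm_power summable_mult summable_geometric)
  then have "abs_convergent_prod (\<lambda>k. 1 + - (a * q ^ k))"
    by (intro summable_imp_abs_convergent_prod) simp
  then show c: "convergent_prod (\<lambda>k. 1 - a * q ^ k)"
    by (auto dest: abs_convergent_prod_imp_convergent_prod)
  show "qpoch a q \<longlonglongrightarrow> qpoch_inf a q"
    using convergent_prod_LIMSEQ[OF c] LIMSEQ_lessThan_iff_atMost
    by (auto simp: qpoch_def[abs_def] qpoch_inf_def LIMSEQ_lessThan_iff_atMost[where f="prod (\<lambda>k. 1 - a * q ^ k)"])
qed

lemma qpoch_inf_split:
  fixes q :: "'a::{real_normed_field,banach}"
  assumes "norm q < 1"
  shows "qpoch_inf a q = qpoch a q n * qpoch_inf (a * q ^ n) q"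
proof -
  have "(\<lambda>k. qpoch a q (n + k)) \<longlonglongrightarrow> qpoch_inf a q"
    using LIMSEQ_ignore_initial_segment[OF qpoch_tendsto_qpoch_inf(1)[OF assms], of a n] by (simp add: add.commute)
  moreover have "(\<lambda>k. qpoch a q (n + k)) \<longlonglongrightarrow> qpoch a q n * qpoch_inf (a * q ^ n) q"
    unfolding qpoch_add by (intro tendsto_intros qpoch_tendsto_qpoch_inf assms)
  ultimately show ?thesis by (rule LIMSEQ_unique)
qed

lemma norm_mult_lt_1: "norm (a * b) < 1" if "norm a < 1" "norm b \<le> 1"
  for a b :: "'a::real_normed_div_algebra"
  using mult_left_mono[OF that(2), of "norm a"] that(1) by (simp add: norm_mult)

lemma qpoch_inf_nonzero:
  fixes q :: "'a::{real_normed_field,banach}"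
  assumes "norm q < 1" "norm a < 1"
  shows "qpoch_inf a q \<noteq> 0"
  unfolding qpoch_inf_def
proof (intro prodinf_nonzero qpoch_tendsto_qpoch_inf assms)
  fix k
  have "norm (a * q ^ k) < 1"
    using assms by (intro norm_mult_lt_1) (simp_all add: norm_power power_le_one)
  then show "1 - a * q ^ k \<noteq> 0" by auto
qed

lemma qpoch_nonzero:
  fixes q :: "'a::{real_normed_field,banach}"
  assumes "norm q < 1" "norm a < 1"
  shows "qpoch a q n \<noteq> 0"
  using qpoch_inf_nonzero[OF assms] qpoch_inf_split[OF assms(1), of a n] by auto

lemma bounded_inverse_qpoch:
  fixes q :: "'a::{real_normed_field,banach}"
  assumes "norm q < 1"
  obtains B where "B > 0" "\<And>n. norm (1 / qpoch q q n) \<le> B"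
proof -
  have "(\<lambda>n. 1 / qpoch q q n) \<longlonglongrightarrow> 1 / qpoch_inf q q"
    by (intro tendsto_intros qpoch_tendsto_qpoch_inf qpoch_inf_nonzero assms)
  then have "Bseq (\<lambda>n. 1 / qpoch q q n)"
    by (rule convergent_imp_Bseq[OF convergentI])
  then show ?thesis using that by (auto elim: BseqE)
qed

text \<open>The sum \<open>f\<close> of the series satisfies \<open>f (q x) = (1 - x) f x\<close>. Iterating, \<open>f (q^n x) = (x)\<^sub>n f x\<close>, and the
left-hand side tends to \<open>f 0 = 1\<close> by continuity of a power series.\<close>

lemma euler_sum:
  fixes x q :: "'a::{real_normed_field,banach}"
  assumes q: "norm q < 1" and x: "norm x < 1"
  shows "(\<lambda>n. x ^ n / qpoch q q n) sums (1 / qpoch_inf x q)"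
    and "summable (\<lambda>n. norm (x ^ n / qpoch q q n))"
proof -
  obtain B where B: "B > 0" "\<And>n. norm (1 / qpoch q q n) \<le> B" using bounded_inverse_qpoch[OF q] by blast
  have sa: "summable (\<lambda>n. norm (x ^ n / qpoch q q n))" if "norm x < 1" for x
  proof (rule summable_comparison_test)
    show "\<exists>N. \<forall>n\<ge>N. norm (norm (x ^ n / qpoch q q n)) \<le> B * norm x ^ n"
    proof (intro exI allI impI)
      fix n
      have "norm (x ^ n / qpoch q q n) = norm (1 / qpoch q q n) * norm x ^ n"
        by (simp add: norm_divide norm_power)
      also have "\<dots> \<le> B * norm x ^ n" using B by (intro mult_right_mono) auto
      finally show "norm (norm (x ^ n / qpoch q q n)) \<le> B * norm x ^ n" by simp
    qed
    show "summable (\<lambda>n. B * norm x ^ n)" using that by (intro summable_mult summable_geometric) auto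
  qed
  define c where "c n = 1 / qpoch q q n" for n
  define f where "f x = (\<Sum>n. c n * x ^ n)" for x
  have sm: "summable (\<lambda>n. c n * x ^ n)" if "norm x < 1" for x
    using summable_norm_cancel[OF sa[OF that]] by (simp add: c_def)
  have nz: "qpoch q q n \<noteq> 0" for n using qpoch_nonzero[OF q q] .
  have step: "f (q * x) = (1 - x) * f x" if x: "norm x < 1" for x
  proof -
    have qx: "norm (q * x) < 1" using q x by (intro norm_mult_lt_1) auto
    have "f x - f (q * x) = (\<Sum>n. c n * x ^ n - c n * (q * x) ^ n)"
      unfolding f_def by (rule suminf_diff) (intro sm x qx)+
    also have "\<dots> = (\<Sum>n. c n * x ^ n * (1 - q ^ n))" by (simp add: algebra_simps)
    also have "\<dots> = (\<Sum>n. c (Suc n) * x ^ Suc n * (1 - q ^ Suc n))"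
      by (subst suminf_split_head)
         (use summable_diff[OF sm[OF x] sm[OF qx]] in \<open>simp_all add: algebra_simps\<close>)
    also have "\<dots> = (\<Sum>n. x * (c n * x ^ n))"
    proof (rule arg_cong[of _ _ suminf], rule ext)
      fix n
      have "c n = c (Suc n) * (1 - q ^ Suc n)"
        using nz[of "Suc n"] by (simp add: c_def qpoch_Suc)
      then show "c (Suc n) * x ^ Suc n * (1 - q ^ Suc n) = x * (c n * x ^ n)" by simp
    qed
    also have "\<dots> = x * f x" unfolding f_def by (rule suminf_mult) (rule sm[OF x])
    finally show ?thesis by (simp add: algebra_simps)
  qed
  have iter: "f (q ^ n * x) = qpoch x q n * f x \<and> norm (q ^ n * x) < 1" for n
  proof (induction n)
    case (Suc n)
    then have "norm (q * (q ^ n * x)) < 1"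
      using q by (intro norm_mult_lt_1) auto
    with Suc step[of "q ^ n * x"] show ?case by (simp add: qpoch_Suc mult_ac)
  qed (simp add: x)
  have "norm (of_real (1/2) :: 'a) < 1" by (subst norm_of_real) simp
  then have "isCont f 0" unfolding f_def
    by (intro isCont_powser[of c "of_real (1/2)"] sm) simp_all
  moreover have "(\<lambda>n. q ^ n * x) \<longlonglongrightarrow> 0"
    by (intro tendsto_mult_left_zero LIMSEQ_power_zero q)
  ultimately have "(\<lambda>n. f (q ^ n * x)) \<longlonglongrightarrow> f 0"
    by (rule isCont_tendsto_compose)
  also have "f 0 = 1" unfolding f_def powser_zero by (simp add: c_def)
  finally have "(\<lambda>n. f (q ^ n * x)) \<longlonglongrightarrow> 1" .
  moreover have "(\<lambda>n. f (q ^ n * x)) \<longlonglongrightarrow> qpoch_inf x q * f x"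
    unfolding iter[THEN conjunct1] by (intro tendsto_intros qpoch_tendsto_qpoch_inf q)
  ultimately have "qpoch_inf x q * f x = 1" by (rule LIMSEQ_unique[symmetric])
  then have "f x = 1 / qpoch_inf x q" using qpoch_inf_nonzero[OF q x] by (simp add: field_simps)
  then show "(\<lambda>n. x ^ n / qpoch q q n) sums (1 / qpoch_inf x q)"
    using summable_sums[OF sm[OF x]] by (simp add: f_def c_def)
  show "summable (\<lambda>n. norm (x ^ n / qpoch q q n))" using sa[OF x] .
qed

section \<open>A \<open>q\<close>-analogue of the Ito polynomials\<close>

lemma prod_qpow_diff_eq_0: "j < i \<Longrightarrow> (\<Prod>a<i. q ^ j - q ^ a) = (0::'a::field)"
  by (subst prod_zero_iff) auto

text \<open>The falling products \<open>\<Prod>a<i. q^j - q^a\<close> vanish for \<open>i > j\<close>. Writing \<open>(q)\<^sub>j / (q)\<^bsub>j-i\<^esub>\<close> through them makes it a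
polynomial in \<open>q^j\<close> and lets sums over \<open>i \<le> min m j\<close> be extended to \<open>i \<le> m\<close>.\<close>

lemma prod_qpow_diff:
  "i \<le> j \<Longrightarrow> (\<Prod>a<i. q ^ j - q ^ a) * qpoch q q (j - i) = (-1) ^ i * q ^ (i choose 2) * qpoch q q j"
proof (induction i)
  case (Suc i)
  define d where "d = j - Suc i"
  have d: "j - i = Suc d" "j = i + Suc d" "j - Suc i = d" using Suc.prems by (auto simp: d_def)
  have c: "Suc i choose 2 = i + (i choose 2)" by (simp add: numeral_2_eq_2)
  have "(\<Prod>a<Suc i. q ^ j - q ^ a) * qpoch q q (j - Suc i)
      = - (q ^ i) * ((\<Prod>a<i. q ^ j - q ^ a) * qpoch q q (j - i))"
    by (simp add: d(1,3) qpoch_Suc, simp add: d(2) power_add algebra_simps)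
  also have "\<dots> = (-1) ^ Suc i * q ^ (Suc i choose 2) * qpoch q q j"
    using Suc by (simp add: c power_add)
  finally show ?case .
qed (simp add: numeral_2_eq_2)

lemma qpoch_inverse_power:
  fixes q :: "'a::field"
  assumes "q \<noteq> 0" "\<And>n. qpoch q q n \<noteq> 0" "k \<le> m"
  shows "qpoch (1 / q ^ m) q k = (-1) ^ k * q ^ (k choose 2) * qpoch q q m / qpoch q q (m - k) / q ^ (m * k)"
proof -
  have "qpoch (1 / q ^ m) q k = (\<Prod>a<k. (q ^ m - q ^ a) / q ^ m)"
    unfolding qpoch_def by (intro prod.cong) (use assms in \<open>auto simp: diff_divide_distrib\<close>)
  also have "\<dots> = (\<Prod>a<k. q ^ m - q ^ a) / q ^ (m * k)"
    by (simp add: prod_dividef power_mult)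
  also have "(\<Prod>a<k. q ^ m - q ^ a) = (-1) ^ k * q ^ (k choose 2) * qpoch q q m / qpoch q q (m - k)"
    using prod_qpow_diff[OF assms(3), of q] assms(2) by (simp add: field_simps)
  finally show ?thesis .
qed

lemma qpoch_inverse_power_eq_0:
  fixes q :: "'a::field"
  assumes "q \<noteq> 0" "m < k"
  shows "qpoch (1 / q ^ m) q k = 0"
  unfolding qpoch_def using assms by (subst prod_zero_iff) auto

text \<open>Both sides have the generating function \<open>\<Sum>m. G\<^sub>m \<tau>^m / (q)\<^sub>m = (\<tau>)\<^sub>\<infinity> / ((x \<tau>)\<^sub>\<infinity> (y \<tau>)\<^sub>\<infinity>)\<close>. The finite proof expands the
falling product by the \<open>q\<close>-binomial theorem; the coefficient of \<open>x^(m-i) y^(i-b)\<close> is a \<open>q\<close>-multinomial, which is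
invariant under the exchange of \<open>m - i\<close> and \<open>i - b\<close>.\<close>

lemma qbinom_falling_sum_symmetric:
  fixes q x y :: "'a::field"
  assumes nz: "\<And>n. qpoch q q n \<noteq> 0"
  shows "(\<Sum>i\<le>m. qbinom q m i * x ^ (m - i) * (\<Prod>a<i. y - q ^ a))
       = (\<Sum>i\<le>m. qbinom q m i * y ^ (m - i) * (\<Prod>a<i. x - q ^ a))"
proof -
  define g where "g x y i b = (-1) ^ b * q ^ (b choose 2) * (qpoch q q m / (qpoch q q (m - i) * qpoch q q b * qpoch q q (i - b)))
     * x ^ (m - i) * y ^ (i - b)" for x y i b
  have *: "(\<Sum>i\<le>m. qbinom q m i * x ^ (m - i) * (\<Prod>a<i. y - q ^ a))
     = (\<Sum>(i,b)\<in>(SIGMA i:{..m}. {..i}). g x y i b)" for x y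
  proof -
    have "qbinom q m i * x ^ (m - i) * (\<Prod>a<i. y - q ^ a) = (\<Sum>b\<le>i. g x y i b)" if "i \<le> m" for i
    proof -
      have "qbinom q m i * x ^ (m - i) * (\<Prod>a<i. y - q ^ a)
         = (\<Sum>b\<le>i. qbinom q m i * x ^ (m - i) * (qbinom q i b * (-1) ^ b * q ^ (b choose 2) * y ^ (i - b)))"
        using gauss_q_binomial[of q i 1 y] by (simp only: sum_distrib_left[symmetric] power_one mult_1_right mult_1)
      also have "\<dots> = (\<Sum>b\<le>i. g x y i b)"
        using that nz by (intro sum.cong) (auto simp: g_def qbinom_eq_divide mult_ac)
      finally show ?thesis .
    qed
    then show ?thesis by (simp add: sum.Sigma)
  qed
  show ?thesis unfolding *
    by (rule sum.reindex_bij_witness[where i = "\<lambda>(i,b). (m - i + b, b)" and j = "\<lambda>(i,b). (m - i + b, b)"])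
       (auto simp: g_def mult_ac)
qed

text \<open>For \<open>v = cnj u\<close> and \<open>q \<rightarrow> 1\<close> (after rescaling) these are the complex Hermite polynomials of Ito, divided by
\<open>m! j!\<close>. The exchange of \<open>m\<close> with \<open>j\<close> corresponds to that of \<open>u\<close> with \<open>v\<close>.\<close>

definition ito_poly :: "'a::field \<Rightarrow> nat \<Rightarrow> nat \<Rightarrow> 'a \<Rightarrow> 'a \<Rightarrow> 'a" where
  "ito_poly q m j u v =
     (\<Sum>i\<le>min m j. (-1) ^ i * q ^ (i choose 2) / (qpoch q q i * qpoch q q (m - i) * qpoch q q (j - i))
        * u ^ (j - i) * v ^ (m - i))"

text \<open>The symmetry in \<open>u v\<close> and \<open>q^j\<close> replaces an expansion in powers of \<open>u v\<close> by one in powers of \<open>q^j\<close>. In a series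
over \<open>j\<close> a power of \<open>q^j\<close> only rescales the variable of a generating function.\<close>

lemma ito_poly_power_expansion:
  fixes q u v :: "'a::field"
  assumes nz: "\<And>n. qpoch q q n \<noteq> 0"
  shows "qpoch q q m * qpoch q q j * ito_poly q m j u v * u ^ m
    = u ^ j * (\<Sum>n\<le>m. qbinom q m n * (q ^ j) ^ (m - n) * (\<Prod>a<n. u * v - q ^ a))"
proof -
  have t: "qpoch q q m * qpoch q q j * ((-1) ^ i * q ^ (i choose 2) / (qpoch q q i * qpoch q q (m - i) * qpoch q q (j - i))
        * u ^ (j - i) * v ^ (m - i)) * u ^ m
      = u ^ j * (qbinom q m i * (u * v) ^ (m - i) * (\<Prod>a<i. q ^ j - q ^ a))"
    if "i \<le> min m j" for i
  proof -
    have P: "(\<Prod>a<i. q ^ j - q ^ a) = (-1) ^ i * q ^ (i choose 2) * qpoch q q j / qpoch q q (j - i)"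
      using prod_qpow_diff[of i j q] nz[of "j - i"] that by (simp add: field_simps)
    have "u ^ (j - i) * u ^ m = u ^ j * u ^ (m - i)" using that by (simp flip: power_add)
    then show ?thesis using that nz unfolding P
      by (simp add: qbinom_eq_divide power_mult_distrib field_simps)
  qed
  have "qpoch q q m * qpoch q q j * ito_poly q m j u v * u ^ m
     = (\<Sum>i\<le>min m j. u ^ j * (qbinom q m i * (u * v) ^ (m - i) * (\<Prod>a<i. q ^ j - q ^ a)))"
    unfolding ito_poly_def sum_distrib_left sum_distrib_right by (intro sum.cong refl t) simp
  also have "\<dots> = (\<Sum>i\<le>m. u ^ j * (qbinom q m i * (u * v) ^ (m - i) * (\<Prod>a<i. q ^ j - q ^ a)))"
    by (rule sum.mono_neutral_left) (auto simp: prod_qpow_diff_eq_0 not_le)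
  also have "\<dots> = u ^ j * (\<Sum>n\<le>m. qbinom q m n * (q ^ j) ^ (m - n) * (\<Prod>a<n. u * v - q ^ a))"
    using qbinom_falling_sum_symmetric[OF nz, of m "u * v" "q ^ j"] by (simp only: sum_distrib_left[symmetric])
  finally show ?thesis .
qed

text \<open>For each \<open>i\<close> the sum over \<open>j \<ge> i\<close> is Euler's series in \<open>c u\<close>, with the same value \<open>1 / (c u)\<^sub>\<infinity>\<close> for every \<open>i\<close>;
the remaining sum over \<open>i\<close> is the \<open>q\<close>-binomial theorem.\<close>

lemma ito_poly_generating_function:
  fixes c q u v :: "'a::{real_normed_field,banach}"
  assumes q: "norm q < 1" and cu: "norm (c * u) < 1"
  shows "(\<lambda>j. c ^ j * ito_poly q m j u v) sums ((\<Prod>a<m. v - c * q ^ a) / (qpoch q q m * qpoch_inf (c * u) q))"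
proof -
  have nz: "qpoch q q n \<noteq> 0" for n using qpoch_nonzero[OF q q] .
  (* f i j is the part of the j-th term that belongs to the i-th monomial; it starts at j = i *)
  define k where "k i = (-1) ^ i * q ^ (i choose 2) * v ^ (m - i) / (qpoch q q i * qpoch q q (m - i))" for i
  define f where "f i j = (if i \<le> j then k i * c ^ j * u ^ (j - i) / qpoch q q (j - i) else 0)" for i j
  have "f i sums (k i * c ^ i * (1 / qpoch_inf (c * u) q))" for i
  proof -
    have "(\<lambda>n. k i * c ^ i * ((c * u) ^ n / qpoch q q n)) sums (k i * c ^ i * (1 / qpoch_inf (c * u) q))"
      by (intro sums_mult euler_sum assms)
    then have "(\<lambda>n. f i (n + i)) sums (k i * c ^ i * (1 / qpoch_inf (c * u) q))"
      by (simp add: f_def power_add power_mult_distrib mult_ac)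
    then show ?thesis by (subst (asm) sums_zero_iff_shift) (auto simp: f_def)
  qed
  then have "(\<lambda>j. \<Sum>i\<le>m. f i j) sums (\<Sum>i\<le>m. k i * c ^ i * (1 / qpoch_inf (c * u) q))"
    by (intro sums_sum)
  also have "(\<lambda>j. \<Sum>i\<le>m. f i j) = (\<lambda>j. c ^ j * ito_poly q m j u v)"
  proof
    fix j
    have "(\<Sum>i\<le>m. f i j) = (\<Sum>i\<le>min m j. f i j)"
      by (rule sum.mono_neutral_right) (auto simp: f_def)
    also have "\<dots> = c ^ j * ito_poly q m j u v"
      unfolding ito_poly_def sum_distrib_left by (intro sum.cong) (auto simp: f_def k_def)
    finally show "(\<Sum>i\<le>m. f i j) = c ^ j * ito_poly q m j u v" .
  qed
  also have "(\<Sum>i\<le>m. k i * c ^ i * (1 / qpoch_inf (c * u) q))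
     = (\<Sum>i\<le>m. qbinom q m i * (-1) ^ i * q ^ (i choose 2) * c ^ i * v ^ (m - i)) / (qpoch q q m * qpoch_inf (c * u) q)"
    unfolding sum_divide_distrib by (intro sum.cong) (auto simp: k_def qbinom_eq_divide[OF nz] nz mult_ac)
  finally show ?thesis unfolding gauss_q_binomial .
qed

text \<open>Here \<open>q^(-m j) (q^j)^(m - n) = (q^(-n))^j\<close>, so that after the expansion of the first factor each summand is the
generating function of the second factor at \<open>c = u / q^n\<close>. The factor \<open>u^m\<close> avoids a division by \<open>u\<close>.\<close>

lemma ito_poly_bilinear_sum:
  fixes q u v u' v' :: "'a::{real_normed_field,banach}"
  assumes q: "norm q < 1" "q \<noteq> 0" and u: "norm (u * u') < norm q ^ m"
  shows "(\<lambda>j. qpoch q q m * qpoch q q j / q ^ (m * j) * ito_poly q m j u v * ito_poly q m j u' v' * u ^ m) sums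
    (\<Sum>n\<le>m. qbinom q m n * (\<Prod>a<n. u * v - q ^ a) *
       ((\<Prod>a<m. v' - u / q ^ n * q ^ a) / (qpoch q q m * qpoch_inf (u * u' / q ^ n) q)))"
proof -
  have nz: "qpoch q q n \<noteq> 0" for n using qpoch_nonzero[OF q(1) q(1)] .
  have "(\<lambda>j. \<Sum>n\<le>m. qbinom q m n * (\<Prod>a<n. u * v - q ^ a) * ((u / q ^ n) ^ j * ito_poly q m j u' v')) sums
    (\<Sum>n\<le>m. qbinom q m n * (\<Prod>a<n. u * v - q ^ a) *
       ((\<Prod>a<m. v' - u / q ^ n * q ^ a) / (qpoch q q m * qpoch_inf (u / q ^ n * u') q)))"
  proof (intro sums_sum sums_mult ito_poly_generating_function q)
    fix n assume "n \<in> {..m}"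
    then have "norm q ^ m \<le> norm q ^ n" using q by (intro power_decreasing) auto
    then have "norm (u * u') < norm q ^ n" using u by simp
    then show "norm (u / q ^ n * u') < 1" using q(2) by (simp add: norm_divide norm_mult norm_power field_simps)
  qed
  also have "(\<lambda>j. \<Sum>n\<le>m. qbinom q m n * (\<Prod>a<n. u * v - q ^ a) * ((u / q ^ n) ^ j * ito_poly q m j u' v'))
    = (\<lambda>j. qpoch q q m * qpoch q q j / q ^ (m * j) * ito_poly q m j u v * ito_poly q m j u' v' * u ^ m)"
  proof
    fix j
    have "qpoch q q m * qpoch q q j / q ^ (m * j) * ito_poly q m j u v * ito_poly q m j u' v' * u ^ m
      = (qpoch q q m * qpoch q q j * ito_poly q m j u v * u ^ m) * ito_poly q m j u' v' / q ^ (m * j)"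
      by simp
    also have "\<dots> = (\<Sum>n\<le>m. qbinom q m n * (\<Prod>a<n. u * v - q ^ a) * ((u / q ^ n) ^ j * ito_poly q m j u' v'))"
      unfolding ito_poly_power_expansion[OF nz] sum_distrib_left sum_distrib_right sum_divide_distrib
    proof (intro sum.cong refl)
      fix n assume "n \<in> {..m}"
      then have "q ^ (m * j) = (q ^ j) ^ (m - n) * (q ^ n) ^ j"
        by (simp add: mult.commute flip: power_mult power_add distrib_left)
      then show "u ^ j * (qbinom q m n * (q ^ j) ^ (m - n) * (\<Prod>a<n. u * v - q ^ a)) * ito_poly q m j u' v' / q ^ (m * j)
         = qbinom q m n * (\<Prod>a<n. u * v - q ^ a) * ((u / q ^ n) ^ j * ito_poly q m j u' v')"
        using q(2) by (simp add: power_divide)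
    qed
    finally show "(\<Sum>n\<le>m. qbinom q m n * (\<Prod>a<n. u * v - q ^ a) * ((u / q ^ n) ^ j * ito_poly q m j u' v')) =
      qpoch q q m * qpoch q q j / q ^ (m * j) * ito_poly q m j u v * ito_poly q m j u' v' * u ^ m" by simp
  qed
  finally show ?thesis by simp
qed

lemma choose_two_double: "n * n = 2 * (n choose 2) + n"
  by (induction n) (auto simp: numeral_2_eq_2)

text \<open>Each factor equals \<open>- (q^a / q^(n + k)) * (1 - y q^(n + k) / q^a)\<close>, and \<open>n + k - a\<close> runs through
\<open>n + 1, \<dots>, n + k\<close>.\<close>

lemma prod_diff_reverse:
  fixes q y :: "'a::field"
  assumes "q \<noteq> 0"
  shows "(\<Prod>a<k. y - q ^ a / q ^ (n + k))
    = (-1) ^ k * q ^ (k choose 2) / q ^ ((n + k) * k) * qpoch (y * q ^ Suc n) q k"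
proof -
  have "qpoch (y * q ^ Suc n) q k = (\<Prod>a<k. 1 - y * q ^ Suc n * q ^ (k - Suc a))"
    unfolding qpoch_def by (rule prod.nat_diff_reindex[symmetric])
  also have "\<dots> = (\<Prod>a<k. 1 - y * q ^ (n + k) / q ^ a)"
  proof (intro prod.cong refl)
    fix a assume "a \<in> {..<k}"
    then have "q ^ Suc n * q ^ (k - Suc a) * q ^ a = q ^ (n + k)" by (simp flip: power_add power_Suc)
    then show "1 - y * q ^ Suc n * q ^ (k - Suc a) = 1 - y * q ^ (n + k) / q ^ a"
      using assms by (simp add: field_simps)
  qed
  finally have r: "qpoch (y * q ^ Suc n) q k = (\<Prod>a<k. 1 - y * q ^ (n + k) / q ^ a)" .
  have "(\<Prod>a<k. y - q ^ a / q ^ (n + k)) = (\<Prod>a<k. (- 1 * q ^ a / q ^ (n + k)) * (1 - y * q ^ (n + k) / q ^ a))"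
    using assms by (intro prod.cong refl) (simp add: field_simps)
  also have "\<dots> = (\<Prod>a<k. - 1 * q ^ a / q ^ (n + k)) * qpoch (y * q ^ Suc n) q k"
    unfolding r by (rule prod.distrib)
  also have "(\<Prod>a<k. - 1 * q ^ a / q ^ (n + k)) = (-1) ^ k * q ^ (k choose 2) / q ^ ((n + k) * k)"
  proof -
    have "(\<Prod>a<k. - 1 * q ^ a / Q) = (-1) ^ k * q ^ (k choose 2) / Q ^ k" for Q
      by (induction k) (auto simp: numeral_2_eq_2 power_add mult_ac)
    then show ?thesis by (simp only: power_mult)
  qed
  finally show ?thesis .
qed

text \<open>The summand with index \<open>k\<close> of the \<open>\<^sub>3\<phi>\<^sub>2\<close>, together with its prefactor, against the summand with index \<open>n = m - k\<close>
of \<open>ito_poly_bilinear_sum\<close>. The infinite products are split at \<open>k\<close> and at \<open>n\<close>, and products with decreasing powers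
of \<open>q\<close> are reversed; what remains is an identity between monomials in \<open>q\<close>.\<close>

lemma phi32_summand_eq:
  fixes q A X r :: complex
  assumes q: "norm q < 1" "q \<noteq> 0" and A: "norm A < norm q ^ m" and X: "norm X < norm q ^ m"
    and r: "r \<noteq> 0" "qpoch (r / q ^ m) q k \<noteq> 0" and m: "m = n + k"
  shows "(1 / q ^ m * qpoch_inf (q / q ^ m * A) q) / (qpoch_inf (X / q ^ m) q * qpoch_inf (q * A) q)
      * (qpoch (q / r) q m / qpoch q q m)
      * ((qpoch (1 / q ^ m) q k * qpoch (X / q ^ m) q k * qpoch r q k)
         / (qpoch (q / q ^ m * A) q k * qpoch (r / q ^ m) q k * qpoch q q k) * q ^ k)
    = qbinom q m n * (\<Prod>a<n. A - q ^ a) * (\<Prod>a<m. 1 / r - q ^ a / q ^ n)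
       / (qpoch q q m * qpoch_inf (X / q ^ n) q)"
proof -
  have nz: "qpoch q q n \<noteq> 0" for n using qpoch_nonzero[OF q(1) q(1)] .
  have mm: "norm q ^ m \<le> 1" using q by (intro power_le_one) auto
  have A1: "norm (A / q ^ m) < 1" and X1: "norm (X / q ^ m) < 1"
    using A X q by (auto simp: norm_divide norm_power)
  have "norm (A / q ^ m * q) < 1" by (intro norm_mult_lt_1 A1) (use q in simp)
  then have A2: "norm (q / q ^ m * A) < 1" by (simp add: mult_ac)
  have kA: "qpoch (q / q ^ m * A) q k \<noteq> 0" by (rule qpoch_nonzero[OF q(1) A2])
  have qA: "qpoch_inf (q * A) q \<noteq> 0"
  proof (rule qpoch_inf_nonzero[OF q(1)])
    have "norm (q * A) < 1" by (rule norm_mult_lt_1) (use q A mm in auto)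
    then show "norm (q * A) < 1" .
  qed
  have kX: "qpoch (X / q ^ m) q k \<noteq> 0" by (rule qpoch_nonzero[OF q(1) X1])
  have f1: "qpoch_inf (q / q ^ m * A) q = qpoch (q / q ^ m * A) q k * (qpoch (A / q ^ n * q) q n * qpoch_inf (q * A) q)"
    using qpoch_inf_split[OF q(1), of "q / q ^ m * A" k] qpoch_inf_split[OF q(1), of "A / q ^ n * q" n] q(2)
    by (simp add: m power_add field_simps)
  have f2: "qpoch_inf (X / q ^ m) q = qpoch (X / q ^ m) q k * qpoch_inf (X / q ^ n) q"
    using qpoch_inf_split[OF q(1), of "X / q ^ m" k] q(2) by (simp add: m power_add)
  have f3: "qpoch (1 / q ^ m) q k = (-1) ^ k * q ^ (k choose 2) * qpoch q q m / qpoch q q n / q ^ (m * k)"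
    using qpoch_inverse_power[OF q(2) nz, of k m] by (simp add: m)
  have f4: "qpoch (A / q ^ n * q) q n = (-1) ^ n * (\<Prod>a<n. A - q ^ a) / q ^ (n choose 2)"
  proof -
    have "(\<Prod>a<n. A - q ^ a) = (\<Prod>a<n. q ^ n * (A / q ^ n - q ^ a / q ^ (0 + n)))"
      using q(2) by (intro prod.cong) (auto simp: field_simps)
    also have "\<dots> = (q ^ n) ^ n * ((-1) ^ n * q ^ (n choose 2) / q ^ (n * n) * qpoch (A / q ^ n * q) q n)"
      unfolding prod.distrib prod_diff_reverse[OF q(2)] by simp
    finally show ?thesis using q(2) by (simp add: power_mult field_simps flip: power_mult_distrib)
  qed
  have f5: "qpoch r q k = r ^ k * (\<Prod>a<k. 1 / r - q ^ a)"
  proof -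
    have "qpoch r q k = (\<Prod>a<k. r * (1 / r - q ^ a))"
      unfolding qpoch_def by (intro prod.cong) (use r in \<open>auto simp: field_simps\<close>)
    then show ?thesis by (simp add: prod.distrib)
  qed
  have f6: "qpoch (q / r) q m = qpoch (q / r) q n * qpoch (1 / r * q ^ Suc n) q k"
    unfolding m qpoch_add by (simp add: mult_ac)
  have f7: "(\<Prod>a<n. 1 / r - q ^ a / q ^ n) = (-1) ^ n * q ^ (n choose 2) / q ^ (n * n) * qpoch (q / r) q n"
    using prod_diff_reverse[OF q(2), of "1 / r" 0 n] by simp
  have f8: "qpoch (r / q ^ m) q k = r ^ k * ((-1) ^ k * q ^ (k choose 2) / q ^ (m * k) * qpoch (1 / r * q ^ Suc n) q k)"
  proof -
    have "qpoch (r / q ^ m) q k = (\<Prod>a<k. r * (1 / r - q ^ a / q ^ (n + k)))"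
      unfolding qpoch_def by (intro prod.cong) (use r m in \<open>auto simp: field_simps\<close>)
    then show ?thesis unfolding prod.distrib prod_diff_reverse[OF q(2)] by (simp add: m)
  qed
  have f9: "(\<Prod>a<m. 1 / r - q ^ a / q ^ n) = (\<Prod>a<n. 1 / r - q ^ a / q ^ n) * (\<Prod>a<k. 1 / r - q ^ a)"
  proof -
    have "(\<Prod>a<n + k. f a) = (\<Prod>a<n. f a) * (\<Prod>a<k. f (n + a))" for f :: "nat \<Rightarrow> complex"
      by (induction k) (simp_all add: mult.assoc)
    then show ?thesis using q(2) by (simp add: m power_add)
  qed
  have qm: "q ^ m = q ^ n * q ^ k" by (simp add: m power_add)
  have qnn: "q ^ (n * n) = q ^ (n choose 2) * q ^ (n choose 2) * q ^ n"
    by (subst choose_two_double) (simp add: power_add mult_2)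
  have nq: "qpoch (1 / r * q ^ Suc n) q k \<noteq> 0" using r f8 by auto
  have b: "qbinom q m n = qpoch q q m / (qpoch q q n * qpoch q q k)"
    using qbinom_eq_divide[OF nz, of n m] by (simp add: m)
  have rk: "r ^ k \<noteq> 0" using r by simp
  (* After the substitutions only cancellation is left; naming the factors keeps the
     normalization from looking inside them. The letters stand, in particular, for q^n, q^k (qn, qk),
     q^(n choose 2), q^(k choose 2) (c, ck), q^(m k) (d), (-1)^n, (-1)^k (mn, mk) and r^k (R). *)
  have E: "((1::complex) / (qn * qk) * (a1 * ((mn * PA / c) * a2))) / ((x1 * x2) * a2) * ((p * p') / M)
     * (((mk * ck * M / N / d) * x1 * (R * PR)) / (a1 * (R * (mk * ck / d * p')) * K) * qk)
     = M / (N * K) * PA * ((mn * c / (c * c * qn) * p) * PR) / (M * x2)"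
    if "qn \<noteq> 0" "qk \<noteq> 0" "a1 \<noteq> 0" "a2 \<noteq> 0" "c \<noteq> 0" "x1 \<noteq> 0" "p' \<noteq> 0" "M \<noteq> 0" "mk \<noteq> 0"
       "ck \<noteq> 0" "N \<noteq> 0" "d \<noteq> 0" "R \<noteq> 0" "K \<noteq> 0"
    for qn qk a1 mn PA c a2 x1 x2 p p' M mk ck N d R PR K
    using that by (simp add: field_simps)
  show ?thesis
    unfolding f1 f2 f3 f4 f5 f6 f8 f9 f7 b qnn
    unfolding qm by (rule E) (use q(2) kA[unfolded qm] qA kX[unfolded qm] nq nz rk in auto)
qed

section \<open>The coefficients of the coherent states\<close>

lemma choose_two_add: "(i + k) choose 2 = (i choose 2) + (k choose 2) + i * k"
  by (induction k) (auto simp: numeral_2_eq_2)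

text \<open>The summation index of the \<open>\<^sub>2\<phi>\<^sub>1\<close> is reversed, \<open>k = n - i\<close>; the powers of \<open>q\<close> then collapse to
\<open>q^(i choose 2) / q^(n choose 2)\<close>.\<close>

lemma wall_poly_eq:
  assumes q: "0 < q" "q < 1"
  shows "wall_poly n x (q ^ d) q = (-1) ^ n / q ^ (n choose 2) * qpoch q q d * qpoch q q n *
    (\<Sum>i\<le>n. (-1) ^ i * q ^ (i choose 2) / (qpoch q q i * qpoch q q (n - i) * qpoch q q (n + d - i)) * x ^ (n - i))"
proof -
  have nz: "qpoch q q k \<noteq> 0" for k using qpoch_pos[OF q, of k] by simp
  define f where "f k = (qpoch (1 / q ^ n) q k * qpoch 0 q k) / (qpoch (q ^ d * q) q k * qpoch q q k) * (q * x) ^ k" for k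
  have "wall_poly n x (q ^ d) q = (\<Sum>k. f k)"
    by (simp add: wall_poly_def phi21_def f_def power_int_minus field_simps)
  also have "\<dots> = (\<Sum>k\<le>n. f k)"
    using q by (intro suminf_finite) (auto simp: f_def qpoch_inverse_power_eq_0 not_le)
  also have "\<dots> = (\<Sum>i\<le>n. f (n - i))"
    by (rule sum.reindex_bij_witness[where i = "\<lambda>i. n - i" and j = "\<lambda>i. n - i"]) auto
  also have "\<dots> = (\<Sum>i\<le>n. (-1) ^ n / q ^ (n choose 2) * qpoch q q d * qpoch q q n *
    ((-1) ^ i * q ^ (i choose 2) / (qpoch q q i * qpoch q q (n - i) * qpoch q q (n + d - i)) * x ^ (n - i)))"
  proof (intro sum.cong refl)
    fix i assume "i \<in> {..n}"
    define k where "k = n - i"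
    with \<open>i \<in> {..n}\<close> have k: "n = i + k" "n - i = k" "n - k = i" "n + d - i = d + k" by auto
    have e: "q ^ (k choose 2) * q ^ k * q ^ (n choose 2) = q ^ (n * k) * q ^ (i choose 2)"
    proof -
      have "(k choose 2) + k + (n choose 2) = n * k + (i choose 2)"
        using choose_two_double[of k] by (simp add: k(1) choose_two_add add_mult_distrib)
      then show ?thesis by (simp flip: power_add)
    qed
    have e': "q ^ (k choose 2) * q ^ k / q ^ (n * k) = q ^ (i choose 2) / q ^ (n choose 2)"
      using e q by (simp add: field_simps)
    have s: "(-1::real) ^ k = (-1) ^ n * (-1) ^ i" by (simp add: k(1) power_add)
    have d: "qpoch (q ^ d * q) q k = qpoch q q (d + k) / qpoch q q d"
      using nz[of d] by (simp add: qpoch_add mult_ac)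
    have 0: "qpoch 0 q k = 1" by (simp add: qpoch_def)
    have "f k = (-1) ^ k * (q ^ (k choose 2) * q ^ k / q ^ (n * k)) * qpoch q q d * qpoch q q n
        / (qpoch q q i * qpoch q q k * qpoch q q (d + k)) * x ^ k"
      unfolding f_def d 0 using qpoch_inverse_power[OF _ nz, of k n] q
      by (simp add: k power_mult_distrib field_simps)
    then show "f (n - i) = (-1) ^ n / q ^ (n choose 2) * qpoch q q d * qpoch q q n *
    ((-1) ^ i * q ^ (i choose 2) / (qpoch q q i * qpoch q q (n - i) * qpoch q q (n + d - i)) * x ^ (n - i))"
      unfolding e' s k(2,4) by simp
  qed
  finally show ?thesis by (simp add: sum_distrib_left)
qed

text \<open>With \<open>d = |m - j|\<close>, the modulus and the phase in \<open>h_coeff\<close> combine to \<open>t^d\<close> if \<open>m \<le> j\<close> and to \<open>(cnj t)^d\<close> otherwise,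
and the argument of the Wall polynomial is \<open>t * cnj t\<close>. Both cases then show the same monomials.\<close>

lemma h_coeff_eq_ito_poly:
  assumes q: "0 < q" "q < 1"
  shows "h_coeff m q j z = complex_of_real (sqrt (qpoch q q m * qpoch q q j / q ^ (m * j))) *
    ito_poly (complex_of_real q) m j (complex_of_real (sqrt (1 - q)) * z) (complex_of_real (sqrt (1 - q)) * cnj z)"
proof -
  have nz: "qpoch q q k > 0" for k using qpoch_pos[OF q, of k] .
  define n d where "n = min m j" and "d = max m j - min m j"
  define a where "a = qpoch q q m * qpoch q q j"
  define b where "b = q ^ (m * j)"
  define t where "t = complex_of_real (sqrt (1 - q)) * z"
  define S where "S = (\<Sum>i\<le>n. (-1) ^ i * q ^ (i choose 2) / (qpoch q q i * qpoch q q (n - i) * qpoch q q (n + d - i))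
     * ((1 - q) * (cmod z)\<^sup>2) ^ (n - i))"
  have ab: "a > 0" "b > 0" using nz q by (auto simp: a_def b_def)
  have nd: "max m j = n + d" by (auto simp: n_def d_def)
  have a: "qpoch q q (n + d) * qpoch q q n = a"
    by (cases "m \<le> j") (auto simp: n_def d_def a_def)
  have tt: "t * cnj t = complex_of_real ((1 - q) * (cmod z)\<^sup>2)"
  proof -
    have "t * cnj t = (complex_of_real (sqrt (1 - q)) * complex_of_real (sqrt (1 - q))) * (z * cnj z)"
      by (simp add: t_def)
    also have "complex_of_real (sqrt (1 - q)) * complex_of_real (sqrt (1 - q)) = complex_of_real (1 - q)"
      using q by (simp flip: of_real_mult)
    finally show ?thesis by (simp only: complex_norm_square[symmetric] of_real_mult)
  qed
  have phase: "complex_of_real (sqrt (1 - q) ^ d * cmod z ^ d) * cis (- (real m - real j) * Arg z)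
     = (if m \<le> j then t ^ d else cnj t ^ d)"
  proof -
    have pol: "z = complex_of_real (cmod z) * cis (Arg z)"
      using rcis_cmod_Arg[of z] by (simp add: rcis_def)
    have zd: "z ^ d = complex_of_real (cmod z) ^ d * cis (real d * Arg z)"
      using arg_cong[OF pol, of "\<lambda>x. x ^ d"] by (simp only: power_mult_distrib Complex.DeMoivre)
    have zc: "cnj z ^ d = complex_of_real (cmod z) ^ d * cis (real d * (- Arg z))"
      using arg_cong[OF zd, of cnj] by (simp add: cis_cnj)
    show ?thesis
    proof (cases "m \<le> j")
      case True
      then have "- (real m - real j) * Arg z = real d * Arg z" by (simp add: d_def)
      moreover have "t ^ d = complex_of_real (sqrt (1 - q) ^ d * cmod z ^ d) * cis (real d * Arg z)"
        by (simp add: t_def power_mult_distrib zd)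
      ultimately show ?thesis using True by (simp only: if_True)
    next
      case False
      then have "- (real m - real j) * Arg z = real d * (- Arg z)" by (simp add: d_def of_nat_diff algebra_simps)
      moreover have "cnj t ^ d = complex_of_real (sqrt (1 - q) ^ d * cmod z ^ d) * cis (real d * (- Arg z))"
        by (simp add: t_def power_mult_distrib zc)
      ultimately show ?thesis using False by (simp only: if_False)
    qed
  qed
  have "h_coeff m q j z = complex_of_real ((-1) ^ n * qpoch q q (n + d) * q ^ (n choose 2) / (qpoch q q d * sqrt (b * a))
      * wall_poly n ((1 - q) * (cmod z)\<^sup>2) (q ^ d) q)
      * (complex_of_real (sqrt (1 - q) ^ d * cmod z ^ d) * cis (- (real m - real j) * Arg z))"
    unfolding h_coeff_def Let_def nd d_def[symmetric] n_def[symmetric] a_def b_def by (simp add: mult_ac)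
  also have "(-1) ^ n * qpoch q q (n + d) * q ^ (n choose 2) / (qpoch q q d * sqrt (b * a))
      * wall_poly n ((1 - q) * (cmod z)\<^sup>2) (q ^ d) q = (qpoch q q (n + d) * qpoch q q n) / sqrt (b * a) * S"
    unfolding wall_poly_eq[OF q] S_def[symmetric]
    using nz[of d] q by (simp add: field_simps flip: power_mult_distrib)
  also have "(qpoch q q (n + d) * qpoch q q n) / sqrt (b * a) = sqrt (a / b)"
    unfolding a using ab real_sqrt_mult_self[of a]
    by (simp add: real_sqrt_mult real_sqrt_divide field_simps)
  also have "complex_of_real (sqrt (a / b) * S)
      * (complex_of_real (sqrt (1 - q) ^ d * cmod z ^ d) * cis (- (real m - real j) * Arg z))
     = complex_of_real (sqrt (a / b)) * (complex_of_real S * (if m \<le> j then t ^ d else cnj t ^ d))"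
    unfolding phase by simp
  also have "complex_of_real S * (if m \<le> j then t ^ d else cnj t ^ d) = ito_poly (complex_of_real q) m j t (cnj t)"
    unfolding ito_poly_def n_def[symmetric] S_def of_real_sum sum_distrib_right
  proof (intro sum.cong refl)
    fix i assume i: "i \<in> {..n}"
    define Q where "Q = complex_of_real q"
    have r: "complex_of_real ((-1) ^ i * q ^ (i choose 2) / (qpoch q q i * qpoch q q (n - i) * qpoch q q (n + d - i))
     * ((1 - q) * (cmod z)\<^sup>2) ^ (n - i)) = (-1) ^ i * Q ^ (i choose 2) / (qpoch Q Q i * qpoch Q Q (n - i) * qpoch Q Q (n + d - i))
      * (t * cnj t) ^ (n - i)"
      unfolding tt Q_def qpoch_of_real by simp
    show "complex_of_real ((-1) ^ i * q ^ (i choose 2) / (qpoch q q i * qpoch q q (n - i) * qpoch q q (n + d - i))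
     * ((1 - q) * (cmod z)\<^sup>2) ^ (n - i)) * (if m \<le> j then t ^ d else cnj t ^ d)
      = (-1) ^ i * complex_of_real q ^ (i choose 2)
         / (qpoch (complex_of_real q) (complex_of_real q) i * qpoch (complex_of_real q) (complex_of_real q) (m - i)
            * qpoch (complex_of_real q) (complex_of_real q) (j - i)) * t ^ (j - i) * cnj t ^ (m - i)"
    proof (cases "m \<le> j")
      case True
      then have e: "n - i = m - i" "n + d - i = j - i" and "j - i = (m - i) + d" using i by (auto simp: n_def d_def)
      from this(3) have t: "t ^ (j - i) = t ^ (m - i) * t ^ d" by (simp only: power_add)
      from True show ?thesis unfolding r unfolding e t Q_def[symmetric] by (simp add: power_mult_distrib)
    next
      case False
      then have e: "n - i = j - i" "n + d - i = m - i" and "m - i = (j - i) + d" using i by (auto simp: n_def d_def)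
      from this(3) have t: "cnj t ^ (m - i) = cnj t ^ (j - i) * cnj t ^ d" by (simp only: power_add)
      from False show ?thesis unfolding r unfolding e t Q_def[symmetric] by (simp add: power_mult_distrib mult_ac)
    qed
  qed
  finally show ?thesis by (simp add: a_def b_def t_def)
qed

lemma cnj_qpoch: "cnj (qpoch a q n) = qpoch (cnj a) (cnj q) n"
  by (simp add: qpoch_def)

lemma cnj_ito_poly:
  "cnj (ito_poly (complex_of_real q) m j u v) = ito_poly (complex_of_real q) m j (cnj u) (cnj v)"
  by (simp add: ito_poly_def cnj_qpoch)

section \<open>The closed form of the series of products\<close>

text \<open>The bilinear sum at \<open>u = cnj t\<close>, \<open>v = t\<close>, \<open>u' = s\<close>, \<open>v' = cnj s\<close>. Since \<open>z \<noteq> 0\<close>, the factor \<open>(cnj t)^m\<close> can be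
cancelled, which leaves products in \<open>cnj s / cnj t = 1 / r\<close>. The condition on \<open>(cnj t) s\<close> holds by the inequality
between the geometric and the arithmetic mean.\<close>

lemma h_coeff_products_sum_to_overlap_formula:
  assumes q: "0 < q" "q < 1" and zw: "(z, w) \<in> regular_pairs m q"
  shows "(\<lambda>j. cnj (h_coeff m q j z) * h_coeff m q j w) sums overlap_formula m q z w"
proof -
  define Q where "Q = complex_of_real q"
  define t s where "t = complex_of_real (sqrt (1 - q)) * z" and "s = complex_of_real (sqrt (1 - q)) * w"
  define r where "r = cnj z / cnj w"
  define A X where "A = (1 - Q) * (z * cnj z)" and "X = (1 - Q) * (w * cnj z)"
  have z: "z \<noteq> 0" "w \<noteq> 0" "(1 - q) * (cmod z)\<^sup>2 < q ^ m" "(1 - q) * (cmod w)\<^sup>2 < q ^ m"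
    and rm: "qpoch (r * Q powi (- int m)) Q m \<noteq> 0"
    using zw by (auto simp: regular_pairs_def coherent_domain_def r_def Q_def)
  have Q: "norm Q < 1" "Q \<noteq> 0" "norm Q = q" using q by (auto simp: Q_def)
  have sq: "complex_of_real (sqrt (1 - q)) * complex_of_real (sqrt (1 - q)) = 1 - Q"
    using q by (simp add: Q_def flip: of_real_mult)
  have tA: "cnj t * t = A" and tX: "cnj t * s = X"
    unfolding A_def X_def sq[symmetric] t_def s_def by (simp_all add: mult_ac)
  have t0: "cnj t \<noteq> 0" using z q by (simp add: t_def)
  have r0: "r \<noteq> 0" and rinv: "cnj s / cnj t = 1 / r" using z q by (simp_all add: r_def t_def s_def)
  have n1Q: "norm (1 - Q) = 1 - q" using q unfolding Q_def by (metis abs_of_nonneg diff_ge_0_iff_ge less_imp_le norm_of_real of_real_1 of_real_diff)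
  have nA: "norm A < norm Q ^ m" using z(3) by (simp add: A_def norm_mult n1Q Q(3) power2_eq_square)
  (* |w| |z| is at most the mean of the squares, each of which is below the bound *)
  have nX: "norm X < norm Q ^ m"
  proof -
    have "cmod w * cmod z \<le> ((cmod z)\<^sup>2 + (cmod w)\<^sup>2) / 2"
      using sum_squares_bound[of "cmod z" "cmod w"] by (simp add: mult_ac)
    then have "(1 - q) * (cmod w * cmod z) \<le> (1 - q) * (((cmod z)\<^sup>2 + (cmod w)\<^sup>2) / 2)"
      using q by (intro mult_left_mono) auto
    also have "\<dots> < q ^ m" using z(3,4) by (simp add: field_simps)
    finally show ?thesis by (simp add: X_def norm_mult n1Q Q(3))
  qed
  have terms: "cnj (h_coeff m q j z) * h_coeff m q j w
     = qpoch Q Q m * qpoch Q Q j / Q ^ (m * j) * ito_poly Q m j (cnj t) t * ito_poly Q m j s (cnj s)" for j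
  proof -
    have p: "0 \<le> qpoch q q m * qpoch q q j / q ^ (m * j)"
      using qpoch_pos[OF q, of m] qpoch_pos[OF q, of j] q by simp
    define R where "R = sqrt (qpoch q q m * qpoch q q j / q ^ (m * j))"
    have R: "R * R = qpoch q q m * qpoch q q j / q ^ (m * j)"
      unfolding R_def real_sqrt_mult_self using p by (rule abs_of_nonneg)
    have "cnj (h_coeff m q j z) * h_coeff m q j w
      = complex_of_real (R * R) * (ito_poly Q m j (cnj t) t * ito_poly Q m j s (cnj s))"
      unfolding h_coeff_eq_ito_poly[OF q] R_def[symmetric]
      by (simp add: cnj_ito_poly t_def s_def Q_def mult_ac)
    also have "\<dots> = complex_of_real (qpoch q q m * qpoch q q j / q ^ (m * j)) * (ito_poly Q m j (cnj t) t * ito_poly Q m j s (cnj s))"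
      unfolding R ..
    finally show ?thesis by (simp add: Q_def qpoch_of_real)
  qed
  define G where "G n = qbinom Q m n * (\<Prod>a<n. A - Q ^ a) * (\<Prod>a<m. 1 / r - Q ^ a / Q ^ n)
       / (qpoch Q Q m * qpoch_inf (X / Q ^ n) Q)" for n
  have pr: "(\<Prod>a<m. cnj s - cnj t / Q ^ n * Q ^ a) = cnj t ^ m * (\<Prod>a<m. 1 / r - Q ^ a / Q ^ n)" for n
  proof -
    have "(\<Prod>a<m. cnj s - cnj t / Q ^ n * Q ^ a) = (\<Prod>a<m. cnj t * (1 / r - Q ^ a / Q ^ n))"
      unfolding rinv[symmetric] using t0 by (intro prod.cong refl) (simp add: field_simps)
    then show ?thesis by (simp add: prod.distrib)
  qed
  have "(\<lambda>j. cnj (h_coeff m q j z) * h_coeff m q j w * cnj t ^ m) sums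
     (\<Sum>n\<le>m. qbinom Q m n * (\<Prod>a<n. cnj t * t - Q ^ a) *
       ((\<Prod>a<m. cnj s - cnj t / Q ^ n * Q ^ a) / (qpoch Q Q m * qpoch_inf (cnj t * s / Q ^ n) Q)))"
    unfolding terms by (rule ito_poly_bilinear_sum) (use Q nX tX in auto)
  also have "\<dots> = (\<Sum>n\<le>m. G n) * cnj t ^ m"
    unfolding tA tX pr sum_distrib_right by (intro sum.cong) (auto simp: G_def)
  finally have "(\<lambda>j. cnj (h_coeff m q j z) * h_coeff m q j w) sums (\<Sum>n\<le>m. G n)"
    using t0 by (subst (asm) sums_mult2_iff) auto
  also have "(\<Sum>n\<le>m. G n) = (\<Sum>k\<le>m. G (m - k))"
    by (rule sum.reindex_bij_witness[where i = "\<lambda>i. m - i" and j = "\<lambda>i. m - i"]) auto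
  also have "\<dots> = overlap_formula m q z w"
  proof -
    define c where "c = (1 / Q ^ m * qpoch_inf (Q / Q ^ m * A) Q) / (qpoch_inf (X / Q ^ m) Q * qpoch_inf (Q * A) Q)
      * (qpoch (Q / r) Q m / qpoch Q Q m)"
    define f where "f k = (qpoch (1 / Q ^ m) Q k * qpoch (X / Q ^ m) Q k * qpoch r Q k)
         / (qpoch (Q / Q ^ m * A) Q k * qpoch (r / Q ^ m) Q k * qpoch Q Q k) * Q ^ k" for k
    have pw: "Q powi (- int m) = 1 / Q ^ m" "Q powi (- int m + 1) = Q / Q ^ m"
      using Q(2) by (simp add: power_int_minus field_simps)
        (subst power_int_add, use Q(2) in \<open>simp_all add: power_int_minus field_simps\<close>)
    have rz: "cnj w / cnj z = 1 / r" by (simp add: r_def)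
    have "overlap_formula m q z w = c * phi32 (1 / Q ^ m) (X / Q ^ m) r (Q / Q ^ m * A) (r / Q ^ m) Q Q"
      unfolding overlap_formula_def Let_def Q_def[symmetric] pw r_def[symmetric] rz c_def A_def X_def
      by (simp add: mult_ac)
    also have "phi32 (1 / Q ^ m) (X / Q ^ m) r (Q / Q ^ m * A) (r / Q ^ m) Q Q = (\<Sum>k. f k)"
      by (simp add: phi32_def f_def)
    also have "\<dots> = (\<Sum>k\<le>m. f k)"
      using Q by (intro suminf_finite) (auto simp: f_def qpoch_inverse_power_eq_0 not_le)
    also have "c * (\<Sum>k\<le>m. f k) = (\<Sum>k\<le>m. G (m - k))"
      unfolding sum_distrib_left
    proof (intro sum.cong refl)
      fix k assume k: "k \<in> {..m}"
      have "qpoch (r / Q ^ m) Q m = qpoch (r / Q ^ m) Q k * qpoch (r / Q ^ m * Q ^ k) Q (m - k)"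
        using k qpoch_add[of "r / Q ^ m" Q k "m - k"] by simp
      then have "qpoch (r / Q ^ m) Q k \<noteq> 0" using rm by (auto simp: pw)
      then show "c * f k = G (m - k)"
        unfolding c_def f_def G_def by (intro phi32_summand_eq) (use Q nA nX r0 k in auto)
    qed
    finally show ?thesis by simp
  qed
  finally show ?thesis .
qed

section \<open>The weight of the continuous \<open>q\<close>-Hermite polynomials\<close>

text \<open>The parameter \<open>a\<close> is \<open>1\<close> for the full product in the weight and \<open>q\<close> for the product without its first factor.\<close>

lemma tendsto_prodinf_quadratic_factors:
  fixes q a c :: real
  assumes q: "0 < q" "q < 1"
  shows "(\<lambda>N. \<Prod>k<N. 1 + c * (a * q ^ k) + (a * q ^ k)\<^sup>2) \<longlonglongrightarrow> (\<Prod>k. 1 + c * (a * q ^ k) + (a * q ^ k)\<^sup>2)"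
proof -
  have "summable (\<lambda>k. norm (c * (a * q ^ k) + (a * q ^ k)\<^sup>2))"
  proof (rule summable_comparison_test)
    show "\<exists>N. \<forall>k\<ge>N. norm (norm (c * (a * q ^ k) + (a * q ^ k)\<^sup>2)) \<le> (\<bar>c * a\<bar> + a\<^sup>2) * q ^ k"
    proof (intro exI allI impI)
      fix k
      have "q ^ k * q ^ k \<le> q ^ k * 1" using q by (intro mult_left_mono power_le_one) auto
      then have "a\<^sup>2 * (q ^ k * q ^ k) \<le> a\<^sup>2 * q ^ k" by (intro mult_left_mono) auto
      then have "(a * q ^ k)\<^sup>2 \<le> a\<^sup>2 * q ^ k" by (simp add: power2_eq_square mult_ac)
      moreover have "\<bar>c * (a * q ^ k)\<bar> = \<bar>c * a\<bar> * q ^ k" using q by (simp add: abs_mult)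
      ultimately show "norm (norm (c * (a * q ^ k) + (a * q ^ k)\<^sup>2)) \<le> (\<bar>c * a\<bar> + a\<^sup>2) * q ^ k"
        using abs_triangle_ineq[of "c * (a * q ^ k)" "(a * q ^ k)\<^sup>2"] by (simp add: distrib_right)
    qed
    show "summable (\<lambda>k. (\<bar>c * a\<bar> + a\<^sup>2) * q ^ k)" using q by (intro summable_mult summable_geometric) auto
  qed
  then have "abs_convergent_prod (\<lambda>k. 1 + (c * (a * q ^ k) + (a * q ^ k)\<^sup>2))"
    by (intro summable_imp_abs_convergent_prod) simp
  then have "convergent_prod (\<lambda>k. 1 + c * (a * q ^ k) + (a * q ^ k)\<^sup>2)"
    by (auto dest: abs_convergent_prod_imp_convergent_prod simp: add.assoc)
  then show ?thesis
    using convergent_prod_LIMSEQ LIMSEQ_lessThan_iff_atMost[where f = "prod (\<lambda>k. 1 + c * (a * q ^ k) + (a * q ^ k)\<^sup>2)"] by auto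
qed

lemma quadratic_factors_bounded:
  fixes q a :: real
  assumes q: "0 < q" "q < 1" and a: "0 \<le> a"
  obtains B where "\<And>c N. \<bar>c\<bar> \<le> 2 \<Longrightarrow> 0 \<le> (\<Prod>k<N. 1 + c * (a * q ^ k) + (a * q ^ k)\<^sup>2)"
    "\<And>c N. \<bar>c\<bar> \<le> 2 \<Longrightarrow> (\<Prod>k<N. 1 + c * (a * q ^ k) + (a * q ^ k)\<^sup>2) \<le> B"
proof -
  have "(\<lambda>N. (qpoch (- a) q N)\<^sup>2) \<longlonglongrightarrow> (qpoch_inf (- a) q)\<^sup>2"
    by (intro tendsto_power qpoch_tendsto_qpoch_inf(1)) (use q in auto)
  then have "Bseq (\<lambda>N. (qpoch (- a) q N)\<^sup>2)"
    by (rule convergent_imp_Bseq[OF convergentI])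
  then obtain B where B: "\<And>N. norm ((qpoch (- a) q N)\<^sup>2) \<le> B" unfolding Bseq_def by blast
  have pos: "0 \<le> 1 + c * x + x\<^sup>2" and le: "1 + c * x + x\<^sup>2 \<le> (1 + x)\<^sup>2" if "\<bar>c\<bar> \<le> 2" "0 \<le> x" for c x :: real
  proof -
    have "c * x \<le> 2 * x" "(-2) * x \<le> c * x" using that by (intro mult_right_mono; simp)+
    then show "0 \<le> 1 + c * x + x\<^sup>2" "1 + c * x + x\<^sup>2 \<le> (1 + x)\<^sup>2"
      using zero_le_power2[of "1 - x"] by (simp_all add: power2_eq_square algebra_simps)
  qed
  show ?thesis
  proof (rule that)
    fix c :: real and N assume c: "\<bar>c\<bar> \<le> 2"
    show "0 \<le> (\<Prod>k<N. 1 + c * (a * q ^ k) + (a * q ^ k)\<^sup>2)"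
      using c a q by (intro prod_nonneg pos ballI) auto
    have "(\<Prod>k<N. 1 + c * (a * q ^ k) + (a * q ^ k)\<^sup>2) \<le> (\<Prod>k<N. (1 + a * q ^ k)\<^sup>2)"
      using c a q by (intro prod_mono conjI pos le) auto
    also have "\<dots> = (qpoch (- a) q N)\<^sup>2" by (simp add: qpoch_def prod_power_distrib)
    also have "\<dots> \<le> B" using B[of N] by simp
    finally show "(\<Prod>k<N. 1 + c * (a * q ^ k) + (a * q ^ k)\<^sup>2) \<le> B" .
  qed
qed

lemma continuous_on_prodinf_quadratic_factors:
  fixes q a :: real
  assumes q: "0 < q" "q < 1" and a: "0 \<le> a"
  shows "continuous_on {-2..2} (\<lambda>c. \<Prod>k. 1 + c * (a * q ^ k) + (a * q ^ k)\<^sup>2)"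
proof -
  have "uniformly_convergent_on {-2..2} (\<lambda>N c. \<Sum>k<N. norm (1 + c * (a * q ^ k) + (a * q ^ k)\<^sup>2 - 1))"
  proof (rule Weierstrass_m_test')
    fix k and c :: real assume "c \<in> {-2..2}"
    then have c: "\<bar>c\<bar> \<le> 2" by auto
    have "q ^ k * q ^ k \<le> q ^ k * 1" using q by (intro mult_left_mono power_le_one) auto
    then have "a\<^sup>2 * (q ^ k * q ^ k) \<le> a\<^sup>2 * q ^ k" by (intro mult_left_mono) auto
    then have 1: "(a * q ^ k)\<^sup>2 \<le> a\<^sup>2 * q ^ k" by (simp add: power2_eq_square mult_ac)
    have "\<bar>c * (a * q ^ k)\<bar> = \<bar>c\<bar> * (a * q ^ k)" using q a by (simp add: abs_mult)
    also have "\<dots> \<le> 2 * (a * q ^ k)" using c a q by (intro mult_right_mono) auto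
    finally have "\<bar>c * (a * q ^ k)\<bar> \<le> 2 * a * q ^ k" by simp
    with 1 show "norm (norm (1 + c * (a * q ^ k) + (a * q ^ k)\<^sup>2 - 1)) \<le> (2 * a + a\<^sup>2) * q ^ k"
      using abs_triangle_ineq[of "c * (a * q ^ k)" "(a * q ^ k)\<^sup>2"] by (simp add: distrib_right)
  next
    show "summable (\<lambda>k. (2 * a + a\<^sup>2) * q ^ k)" using q by (intro summable_mult summable_geometric) auto
  qed
  then have "uniformly_convergent_on {-2..2} (\<lambda>N c. \<Prod>k<N. 1 + c * (a * q ^ k) + (a * q ^ k)\<^sup>2)"
    by (intro uniformly_convergent_on_prod') (auto intro!: continuous_intros)
  then obtain l where l: "uniform_limit {-2..2} (\<lambda>N c. \<Prod>k<N. 1 + c * (a * q ^ k) + (a * q ^ k)\<^sup>2) l sequentially"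
    by (auto simp: uniformly_convergent_on_def)
  have "continuous_on {-2..2} l"
    by (rule uniform_limit_theorem[OF _ l]) (auto intro!: continuous_intros always_eventually)
  also have "continuous_on {-2..2} l \<longleftrightarrow> ?thesis"
  proof (intro continuous_on_cong refl)
    fix c :: real assume "c \<in> {-2..2}"
    then show "l c = (\<Prod>k. 1 + c * (a * q ^ k) + (a * q ^ k)\<^sup>2)"
      using tendsto_uniform_limitI[OF l] tendsto_prodinf_quadratic_factors[OF q] LIMSEQ_unique by blast
  qed
  finally show ?thesis .
qed

text \<open>This is \<open>(e^(2 i \<theta>))\<^sub>\<infinity> (e^(-2 i \<theta>))\<^sub>\<infinity>\<close>, the weight for the measure \<open>d\<theta>\<close>.\<close>

definition theta_weight :: "real \<Rightarrow> real \<Rightarrow> real" where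
  "theta_weight q \<theta> = (\<Prod>k. 1 + (- 2 * cos (2 * \<theta>)) * q ^ k + q ^ (2 * k))"

definition theta_weight_trunc :: "real \<Rightarrow> nat \<Rightarrow> real \<Rightarrow> real" where
  "theta_weight_trunc q N \<theta> = (\<Prod>k<N. 1 + (- 2 * cos (2 * \<theta>)) * q ^ k + q ^ (2 * k))"

lemma theta_weight_trunc_tendsto:
  "0 < q \<Longrightarrow> q < 1 \<Longrightarrow> (\<lambda>N. theta_weight_trunc q N \<theta>) \<longlonglongrightarrow> theta_weight q \<theta>"
  using tendsto_prodinf_quadratic_factors[of q "- 2 * cos (2 * \<theta>)" 1]
  by (simp add: theta_weight_trunc_def theta_weight_def power_mult power2_eq_square power_mult_distrib mult_ac flip: power_add)

lemma theta_weight_trunc_bounded: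
  assumes "0 < q" "q < 1"
  obtains B where "\<And>N \<theta>. \<bar>theta_weight_trunc q N \<theta>\<bar> \<le> B"
proof -
  obtain B where B: "\<And>c N. \<bar>c\<bar> \<le> 2 \<Longrightarrow> 0 \<le> (\<Prod>k<N. 1 + c * (1 * q ^ k) + (1 * q ^ k)\<^sup>2)"
    "\<And>c N. \<bar>c\<bar> \<le> 2 \<Longrightarrow> (\<Prod>k<N. 1 + c * (1 * q ^ k) + (1 * q ^ k)\<^sup>2) \<le> B"
    using quadratic_factors_bounded[of q 1] assms by auto
  have e: "theta_weight_trunc q N \<theta> = (\<Prod>k<N. 1 + (- 2 * cos (2 * \<theta>)) * (1 * q ^ k) + (1 * q ^ k)\<^sup>2)" for N \<theta>
    by (simp add: theta_weight_trunc_def mult.commute[of 2] power_mult)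
  show ?thesis
    by (rule that[of B], unfold e, subst abs_of_nonneg, (intro B; simp add: abs_mult)+)
qed

section \<open>Fourier coefficients of the weight\<close>

text \<open>The binomial coefficient \<open>j choose 2\<close> for integer \<open>j\<close>, negative values included: the exponents of a theta series.\<close>

definition tri :: "int \<Rightarrow> int" where "tri j = j * (j - 1) div 2"

lemma two_tri: "2 * tri j = j * (j - 1)"
  by (simp add: tri_def)

lemma tri_0 [simp]: "tri 0 = 0" and tri_1 [simp]: "tri 1 = 0"
  by (simp_all add: tri_def)

lemma tri_uminus: "tri (- k) = tri (k + 1)" and tri_1_minus: "tri (1 - k) = tri k"
  using two_tri[of "- k"] two_tri[of "k + 1"] two_tri[of "1 - k"] two_tri[of k] by (simp_all add: algebra_simps)

lemma powi_tri_diff: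
  fixes Q :: "'a::field"
  assumes "Q \<noteq> 0"
  shows "Q powi tri (int l - int M) = Q ^ (l choose 2) * Q ^ ((M choose 2) + M) / Q ^ (l * M)"
proof -
  have c: "2 * int (n choose 2) = int n * (int n - 1)" for n
    using arg_cong[OF choose_two_double[of n], of int] by (simp add: algebra_simps)
  have "tri (int l - int M) + int (l * M) = int ((l choose 2) + ((M choose 2) + M))"
    using two_tri[of "int l - int M"] c[of l] c[of M] by (simp add: algebra_simps)
  then have "Q powi (tri (int l - int M) + int (l * M)) = Q ^ (l choose 2) * Q ^ ((M choose 2) + M)"
    by (simp only: power_int_of_nat power_add)
  then have "Q powi tri (int l - int M) * Q ^ (l * M) = Q ^ (l choose 2) * Q ^ ((M choose 2) + M)"
    by (simp only: power_int_add[OF disjI1[OF assms]] power_int_of_nat)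
  then show ?thesis using assms by (simp only: nonzero_eq_divide_eq power_not_zero not_False_eq_True)
qed

text \<open>As \<open>tri (N - k) = tri N + (k choose 2) + (1 - N) k\<close>, this is the \<open>q\<close>-binomial theorem at \<open>x = q^(1 - N)\<close>.\<close>

lemma sum_qbinom_powi_tri:
  fixes Q :: "'a::field"
  assumes Q: "Q \<noteq> 0"
  shows "(\<Sum>k\<le>n. qbinom Q n k * (-1) ^ k * Q powi tri (N - int k)) = Q powi tri N * (\<Prod>i<n. 1 - Q powi (1 - N) * Q ^ i)"
proof -
  have t: "Q powi tri (N - int k) = Q powi tri N * (Q ^ (k choose 2) * (Q powi (1 - N)) ^ k)" for k
  proof -
    have c: "2 * int (k choose 2) = int k * (int k - 1)"
      using arg_cong[OF choose_two_double[of k], of int] by (simp add: algebra_simps)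
    have "tri (N - int k) = tri N + (int (k choose 2) + (1 - N) * int k)"
      using two_tri[of "N - int k"] two_tri[of N] c by (simp add: algebra_simps)
    then show ?thesis using Q by (simp add: power_int_add power_int_mult)
  qed
  show ?thesis
  proof -
    have "(\<Sum>k\<le>n. qbinom Q n k * (-1) ^ k * Q powi tri (N - int k)) = Q powi tri N *
      (\<Sum>k\<le>n. qbinom Q n k * (-1) ^ k * Q ^ (k choose 2) * (Q powi (1 - N)) ^ k * 1 ^ (n - k))"
      unfolding t by (simp add: sum_distrib_left mult_ac)
    then show ?thesis by (simp only: gauss_q_binomial)
  qed
qed

lemma qpoch_self_eq: "qpoch q q n = (\<Prod>i<n. 1 - q ^ Suc i)"
  by (simp add: qpoch_def)

text \<open>For \<open>0 < N \<le> n\<close> the factor with \<open>i = N - 1\<close> of \<open>\<Prod>i<n. 1 - q^(1 - N) q^i\<close> vanishes; for \<open>N + 1\<close> in place of \<open>N\<close>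
such a factor exists if \<open>N < n\<close>. These zeros are the source of orthogonality.\<close>

lemma sum_qbinom_moments:
  fixes Q :: "'a::field"
  assumes Q: "Q \<noteq> 0" and nz: "\<And>k. qpoch Q Q k \<noteq> 0" and N: "N \<le> n"
  shows "(\<Sum>k\<le>n. qbinom Q n k * (-1) ^ k * Q powi tri (int N - int k)) = (if N = 0 then qpoch Q Q n else 0)"
    and "(\<Sum>k\<le>n. qbinom Q n k * (-1) ^ k * Q powi tri (int N - int k + 1)) = (if N = n then (-1) ^ n * qpoch Q Q n else 0)"
proof -
  show "(\<Sum>k\<le>n. qbinom Q n k * (-1) ^ k * Q powi tri (int N - int k)) = (if N = 0 then qpoch Q Q n else 0)"
  proof (cases "N = 0")
    case False
    then have "N - 1 \<in> {..<n}" "Q powi (1 - int N) * Q ^ (N - 1) = 1"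
      using N Q by (auto simp: of_nat_diff simp flip: power_int_of_nat power_int_add)
    then have "(\<Prod>i<n. 1 - Q powi (1 - int N) * Q ^ i) = 0"
      by (subst prod_zero_iff) (auto intro!: bexI[of _ "N - 1"])
    then show ?thesis using False by (simp add: sum_qbinom_powi_tri[OF Q])
  qed (use sum_qbinom_powi_tri[OF Q, of n 0] in \<open>simp add: qpoch_self_eq\<close>)
  have s: "int N - int k + 1 = (int N + 1) - int k" for k by simp
  have p: "Q powi (1 - (int N + 1)) = 1 / Q ^ N" by (simp add: power_int_minus field_simps)
  show "(\<Sum>k\<le>n. qbinom Q n k * (-1) ^ k * Q powi tri (int N - int k + 1)) = (if N = n then (-1) ^ n * qpoch Q Q n else 0)"
    unfolding s sum_qbinom_powi_tri[OF Q] p qpoch_def[symmetric]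
  proof (cases "N = n")
    case True
    have c: "tri (int n + 1) = int ((n choose 2) + n)"
      using two_tri[of "int n + 1"] arg_cong[OF choose_two_double[of n], of int] by (simp add: algebra_simps)
    have "Q powi tri (int N + 1) * qpoch (1 / Q ^ N) Q n
       = Q ^ ((n choose 2) + n) * ((-1) ^ n * Q ^ (n choose 2) * qpoch Q Q n / Q ^ (n * n))"
      unfolding True c power_int_of_nat using qpoch_inverse_power[OF Q nz, of n n] by simp
    also have "Q ^ (n * n) = Q ^ ((n choose 2) + n) * Q ^ (n choose 2)"
      by (subst choose_two_double) (simp add: mult_2 add_ac flip: power_add)
    finally show "Q powi tri (int N + 1) * qpoch (1 / Q ^ N) Q n = (if N = n then (-1) ^ n * qpoch Q Q n else 0)"
      using Q True by simp
  next
    case False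
    then show "Q powi tri (int N + 1) * qpoch (1 / Q ^ N) Q n = (if N = n then (-1) ^ n * qpoch Q Q n else 0)"
      using N Q by (simp add: qpoch_inverse_power_eq_0)
  qed
qed

text \<open>Up to the factor \<open>1 - 1 / y\<close> and a monomial in \<open>y\<close> and \<open>Q\<close>, reversing the factors \<open>1 - Q^i / y\<close> makes the left-hand side a single product
\<open>\<Prod>i<2 M + 1. 1 - (y / Q^M) Q^i\<close>, to which the \<open>q\<close>-binomial theorem applies. For \<open>M \<rightarrow> \<infinity>\<close> this becomes the triple product
identity.\<close>

lemma finite_jacobi_triple_product:
  fixes Q y :: "'a::field"
  assumes Q: "Q \<noteq> 0" and y: "y \<noteq> 0"
  shows "qpoch y Q (Suc M) * qpoch (1 / y) Q (Suc M)
    = (1 - 1 / y) * (\<Sum>l\<le>2*M+1. qbinom Q (2*M+1) l * (-1) ^ (l + M) * Q powi tri (int l - int M) * y ^ l / y ^ M)"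
proof -
  have split: "(\<Prod>a<n + k. f a) = (\<Prod>a<n. f a) * (\<Prod>a<k. f (n + a))" for f :: "nat \<Rightarrow> 'a" and n k
    by (induction k) (simp_all add: mult.assoc)
  have 1: "qpoch (1 / y) Q (Suc M) = (1 - 1 / y) * qpoch (1 / y * Q) Q M"
    using qpoch_add[of "1 / y" Q 1 M] by (simp add: qpoch_def)
  have 2: "(\<Prod>a<M. 1 / y - Q ^ a / Q ^ M) = (-1) ^ M * Q ^ (M choose 2) / Q ^ (M * M) * qpoch (1 / y * Q) Q M"
    using prod_diff_reverse[OF Q, of "1 / y" 0 M] by simp
  have 3: "(\<Prod>i<2*M+1. 1 - y / Q ^ M * Q ^ i) = y ^ M * (\<Prod>a<M. 1 / y - Q ^ a / Q ^ M) * qpoch y Q (Suc M)"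
  proof -
    have "(\<Prod>i<2*M+1. 1 - y / Q ^ M * Q ^ i) = (\<Prod>i<M. 1 - y / Q ^ M * Q ^ i) * (\<Prod>i<Suc M. 1 - y / Q ^ M * Q ^ (M + i))"
      using split[of "\<lambda>i. 1 - y / Q ^ M * Q ^ i" M "Suc M"] by (simp add: mult_2)
    also have "(\<Prod>i<M. 1 - y / Q ^ M * Q ^ i) = (\<Prod>a<M. y * (1 / y - Q ^ a / Q ^ M))"
      using y by (intro prod.cong) (auto simp: field_simps)
    also have "(\<Prod>i<Suc M. 1 - y / Q ^ M * Q ^ (M + i)) = qpoch y Q (Suc M)"
      unfolding qpoch_def using Q by (intro prod.cong) (auto simp: power_add)
    finally show ?thesis by (simp add: prod.distrib)
  qed
  have "qpoch y Q (Suc M) * qpoch (1 / y * Q) Q M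
     = (-1) ^ M * Q ^ ((M choose 2) + M) / y ^ M * (\<Prod>i<2*M+1. 1 - y / Q ^ M * Q ^ i)"
  proof -
    have "Q ^ (M * M) = Q ^ ((M choose 2) + M) * Q ^ (M choose 2)"
      by (subst choose_two_double) (simp add: mult_2 add_ac flip: power_add)
    then show ?thesis unfolding 3 2 using Q y by (simp flip: power_mult_distrib)
  qed
  also have "\<dots> = (-1) ^ M * Q ^ ((M choose 2) + M) / y ^ M *
     (\<Sum>k\<le>2*M+1. qbinom Q (2*M+1) k * (-1) ^ k * Q ^ (k choose 2) * (y / Q ^ M) ^ k * 1 ^ (2*M+1 - k))"
    by (simp only: gauss_q_binomial)
  also have "\<dots> = (\<Sum>l\<le>2*M+1. qbinom Q (2*M+1) l * (-1) ^ (l + M) * Q powi tri (int l - int M) * y ^ l / y ^ M)"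
    unfolding sum_distrib_left
  proof (intro sum.cong refl)
    fix l
    have e: "(y / Q ^ M) ^ l = y ^ l / Q ^ (l * M)"
      by (simp only: power_divide mult.commute[of l M] power_mult)
    show "(-1) ^ M * Q ^ ((M choose 2) + M) / y ^ M *
       (qbinom Q (2*M+1) l * (-1) ^ l * Q ^ (l choose 2) * (y / Q ^ M) ^ l * 1 ^ (2*M+1 - l))
      = qbinom Q (2*M+1) l * (-1) ^ (l + M) * Q powi tri (int l - int M) * y ^ l / y ^ M"
      unfolding e powi_tri_diff[OF Q] by (simp add: power_add[of "-1"] mult_ac)
  qed
  finally show ?thesis unfolding 1 by (simp add: mult_ac)
qed

lemma has_integral_cis:
  "((\<lambda>\<theta>. cis (of_int a * \<theta>)) has_integral (if a = 0 then 2 * of_real pi else 0)) {-pi..pi}"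
proof (cases "a = 0")
  case True
  then show ?thesis using has_integral_const_real[of "1::complex" "-pi" pi] by (simp add: scaleR_conv_of_real)
next
  case False
  have "((\<lambda>\<theta>. cis (of_int a * \<theta>)) has_integral
     (1 / (\<i> * of_int a) * cis (of_int a * pi) - 1 / (\<i> * of_int a) * cis (of_int a * (- pi)))) {-pi..pi}"
  proof (rule fundamental_theorem_of_calculus)
    fix x :: real
    have "((\<lambda>x. 1 / (\<i> * of_int a) * cis (of_int a * x)) has_derivative
       (\<lambda>t. 1 / (\<i> * of_int a) * ((of_int a * t) *\<^sub>R (\<i> * cis (of_int a * x))))) (at x within {-pi..pi})"
      by (rule has_derivative_mult_right) (auto intro!: derivative_eq_intros)
    also have "(\<lambda>t. 1 / (\<i> * of_int a) * ((of_int a * t) *\<^sub>R (\<i> * cis (of_int a * x)))) = (\<lambda>t. t *\<^sub>R cis (of_int a * x))"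
      using False by (simp add: scaleR_conv_of_real fun_eq_iff divide_simps) (simp add: complex_eq_iff)
    finally show "((\<lambda>x. 1 / (\<i> * of_int a) * cis (of_int a * x)) has_vector_derivative cis (of_int a * x)) (at x within {-pi..pi})"
      by (simp add: has_vector_derivative_def)
  qed simp
  moreover have "cis (of_int a * pi) = cis (of_int a * (- pi))"
    by (simp add: complex_eq_iff mult.commute[of _ pi])
  ultimately show ?thesis using False by simp
qed

lemma theta_weight_trunc_eq_qpoch:
  "complex_of_real (theta_weight_trunc q N \<theta>)
    = qpoch (cis (2 * \<theta>)) (complex_of_real q) N * qpoch (1 / cis (2 * \<theta>)) (complex_of_real q) N"
proof -
  have "complex_of_real (1 + (- 2 * cos (2 * \<theta>)) * q ^ k + q ^ (2 * k))
      = (1 - cis (2 * \<theta>) * complex_of_real q ^ k) * (1 - 1 / cis (2 * \<theta>) * complex_of_real q ^ k)" for k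
  proof -
    have "complex_of_real (1 + (- 2 * cos (2 * \<theta>)) * q ^ k + q ^ (2 * k))
      = 1 - complex_of_real (2 * cos (2 * \<theta>)) * complex_of_real q ^ k + complex_of_real q ^ k * complex_of_real q ^ k"
      by (simp add: mult.commute[of 2 k] power_mult power2_eq_square)
    also have "complex_of_real (2 * cos (2 * \<theta>)) = cis (2 * \<theta>) + 1 / cis (2 * \<theta>)"
      by (simp add: complex_eq_iff flip: cis_inverse inverse_eq_divide)
    also have "1 - (cis (2 * \<theta>) + 1 / cis (2 * \<theta>)) * complex_of_real q ^ k + complex_of_real q ^ k * complex_of_real q ^ k
       = (1 - cis (2 * \<theta>) * complex_of_real q ^ k) * (1 - 1 / cis (2 * \<theta>) * complex_of_real q ^ k)"
      by (simp add: field_simps)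
    finally show ?thesis .
  qed
  then show ?thesis
    unfolding theta_weight_trunc_def qpoch_def by (simp only: of_real_prod prod.distrib)
qed

lemma cis_times_one_minus_inverse: "cis (of_int (2 * j) * \<theta>) * (1 - 1 / cis (2 * \<theta>)) = cis (of_int (2 * j) * \<theta>) - cis (of_int (2 * j - 2) * \<theta>)"
  by (simp add: right_diff_distrib cis_divide left_diff_distrib)

lemma theta_weight_trunc_fourier:
  fixes q :: real
  assumes "0 < q"
  defines "Q \<equiv> complex_of_real q"
  shows "complex_of_real (theta_weight_trunc q (Suc M) \<theta>)
    = (\<Sum>l\<le>2*M+1. qbinom Q (2*M+1) l * (-1) ^ (l + M) * Q powi tri (int l - int M) *
        (cis (of_int (2 * (int l - int M)) * \<theta>) - cis (of_int (2 * (int l - int M) - 2) * \<theta>)))"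
proof -
  have Q: "Q \<noteq> 0" using assms by (simp add: Q_def)
  have y: "cis (2 * \<theta>) ^ l / cis (2 * \<theta>) ^ M = cis (of_int (2 * (int l - int M)) * \<theta>)" for l
    unfolding Complex.DeMoivre cis_divide by (rule arg_cong[of _ _ cis]) (simp add: algebra_simps)
  have "complex_of_real (theta_weight_trunc q (Suc M) \<theta>)
    = (\<Sum>l\<le>2*M+1. qbinom Q (2*M+1) l * (-1) ^ (l + M) * Q powi tri (int l - int M) * (cis (2 * \<theta>) ^ l / cis (2 * \<theta>) ^ M * (1 - 1 / cis (2 * \<theta>))))"
    unfolding theta_weight_trunc_eq_qpoch Q_def[symmetric] finite_jacobi_triple_product[OF Q cis_neq_zero] sum_distrib_left
    by (simp add: mult_ac)
  then show ?thesis unfolding y cis_times_one_minus_inverse .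
qed

text \<open>All frequencies of the truncated weight are even, so the odd moments vanish. For the moment \<open>2 k\<close> exactly two
coefficients of the Laurent polynomial contribute, those with index \<open>M - k\<close> and \<open>M + 1 - k\<close>; the bound on \<open>k\<close>
ensures that both indices lie in the range of summation.\<close>

lemma theta_weight_trunc_moment:
  fixes q :: real
  assumes "0 < q"
  defines "Q \<equiv> complex_of_real q"
  shows "odd p \<Longrightarrow> ((\<lambda>\<theta>. cis (of_int p * \<theta>) * complex_of_real (theta_weight_trunc q (Suc M) \<theta>)) has_integral 0) {-pi..pi}"
    and "\<bar>k\<bar> \<le> int M \<Longrightarrow> ((\<lambda>\<theta>. cis (of_int (2 * k) * \<theta>) * complex_of_real (theta_weight_trunc q (Suc M) \<theta>)) has_integral
      2 * of_real pi * (-1) powi k * (qbinom Q (2*M+1) (nat (int M - k)) * Q powi tri (k + 1)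
         + qbinom Q (2*M+1) (nat (int M + 1 - k)) * Q powi tri k)) {-pi..pi}"
proof -
  define e where "e l = qbinom Q (2*M+1) l * (-1) ^ (l + M) * Q powi tri (int l - int M)" for l
  define I where "I a = (if a = 0 then 2 * complex_of_real pi else 0)" for a :: int
  have *: "((\<lambda>\<theta>. cis (of_int p * \<theta>) * complex_of_real (theta_weight_trunc q (Suc M) \<theta>)) has_integral
     (\<Sum>l\<le>2*M+1. e l * (I (p + 2 * (int l - int M)) - I (p + (2 * (int l - int M) - 2))))) {-pi..pi}" for p
  proof -
    have c: "cis (of_int a * \<theta>) * cis (of_int b * \<theta>) = cis (of_int (a + b) * \<theta>)" for a b \<theta>
      by (simp add: cis_mult distrib_right)
    have "(\<lambda>\<theta>. cis (of_int p * \<theta>) * complex_of_real (theta_weight_trunc q (Suc M) \<theta>)) =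
      (\<lambda>\<theta>. \<Sum>l\<le>2*M+1. e l * (cis (of_int (p + 2 * (int l - int M)) * \<theta>) - cis (of_int (p + (2 * (int l - int M) - 2)) * \<theta>)))"
      unfolding theta_weight_trunc_fourier[OF assms(1)] Q_def[symmetric] e_def[symmetric] sum_distrib_left c[symmetric]
      by (simp only: right_diff_distrib mult.left_commute)
    then show ?thesis
      unfolding I_def by (auto intro!: has_integral_sum has_integral_mult_right has_integral_diff has_integral_cis simp only: finite_atMost)
  qed
  show "((\<lambda>\<theta>. cis (of_int p * \<theta>) * complex_of_real (theta_weight_trunc q (Suc M) \<theta>)) has_integral 0) {-pi..pi}"
    if "odd p"
  proof -
    have "p + 2 * (int l - int M) \<noteq> 0" "p + (2 * (int l - int M) - 2) \<noteq> 0" for l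
      using that by presburger+
    then show ?thesis using *[of p] by (simp add: I_def)
  qed
  assume k: "\<bar>k\<bar> \<le> int M"
  have d: "(\<Sum>l\<le>2*M+1. e l * I (2 * (int l - int n))) = 2 * of_real pi * e n" if "n \<le> 2*M+1" for n
  proof -
    have "(\<Sum>l\<le>2*M+1. e l * I (2 * (int l - int n))) = (\<Sum>l\<le>2*M+1. if l = n then 2 * of_real pi * e n else 0)"
      by (intro sum.cong) (auto simp: I_def)
    then show ?thesis using that by simp
  qed
  define n where "n = nat (int M - k)"
  have n: "int n = int M - k" "n \<le> 2 * M" "nat (int M + 1 - k) = Suc n" using k by (auto simp: n_def)
  have a: "2 * k + 2 * (int l - int M) = 2 * (int l - int n)"
    "2 * k + (2 * (int l - int M) - 2) = 2 * (int l - int (Suc n))" for l using n by auto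
  have s: "(-1) ^ (n + M) = ((-1) powi k :: complex)"
  proof -
    have "(-1) ^ (n + M) = ((-1) powi (int n + int M) :: complex)" by (simp flip: power_int_of_nat)
    also have "int n + int M = 2 * int M + (- k)" using n by simp
    also have "(-1) powi \<dots> = ((-1) powi (- k) :: complex)" by (subst power_int_add) (simp_all add: power_int_mult)
    also have "\<dots> = (-1) powi k"
    proof -
      have "(-1) powi k * (-1) powi k = (1::complex)" by (simp flip: power_int_mult_distrib)
      then show ?thesis unfolding power_int_minus by (rule inverse_unique)
    qed
    finally show ?thesis .
  qed
  have s': "(-1) ^ (Suc n + M) = - ((-1) powi k :: complex)" using s by simp
  have t: "int n - int M = - k" "int (Suc n) - int M = 1 - k" using n by auto
  have "(\<Sum>l\<le>2*M+1. e l * (I (2 * k + 2 * (int l - int M)) - I (2 * k + (2 * (int l - int M) - 2)))) = 2 * of_real pi * e n - 2 * of_real pi * e (Suc n)"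
    using d[of n] d[of "Suc n"] n(2) unfolding a
    by (simp only: right_diff_distrib[where a = "e l" for l] sum_subtractf)
  also have "\<dots> = 2 * of_real pi * (-1) powi k * (qbinom Q (2*M+1) n * Q powi tri (k + 1) + qbinom Q (2*M+1) (Suc n) * Q powi tri k)"
    unfolding e_def t tri_uminus tri_1_minus s s' by (simp add: distrib_left mult_ac del: qbinom.simps)
  finally show "((\<lambda>\<theta>. cis (of_int (2 * k) * \<theta>) * complex_of_real (theta_weight_trunc q (Suc M) \<theta>)) has_integral
      2 * of_real pi * (-1) powi k * (qbinom Q (2*M+1) (nat (int M - k)) * Q powi tri (k + 1)
         + qbinom Q (2*M+1) (nat (int M + 1 - k)) * Q powi tri k)) {-pi..pi}"
    using *[of "2 * k"] unfolding n(3) n_def[symmetric] by simp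
qed

lemma qbinom_central_tendsto:
  fixes Q :: "'a::{real_normed_field,banach}"
  assumes "norm Q < 1"
  shows "(\<lambda>M. qbinom Q (2*M+1) (nat (int M - k))) \<longlonglongrightarrow> 1 / qpoch_inf Q Q"
proof -
  have nz: "qpoch Q Q n \<noteq> 0" for n by (rule qpoch_nonzero[OF assms assms])
  have nzi: "qpoch_inf Q Q \<noteq> 0" by (rule qpoch_inf_nonzero[OF assms assms])
  have lim: "(\<lambda>M. qpoch Q Q (f M)) \<longlonglongrightarrow> qpoch_inf Q Q" if "filterlim f at_top sequentially" for f
    using filterlim_compose[OF qpoch_tendsto_qpoch_inf(1)[OF assms] that] by simp
  have f1: "filterlim (\<lambda>M. nat (int M - k)) at_top sequentially"
    unfolding filterlim_at_top
  proof
    fix Z show "\<forall>\<^sub>F M in sequentially. Z \<le> nat (int M - k)"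
      using eventually_ge_at_top[of "Z + nat \<bar>k\<bar>"] by eventually_elim auto
  qed
  have f2: "filterlim (\<lambda>M. 2 * M + 1 - nat (int M - k)) at_top sequentially"
    unfolding filterlim_at_top
  proof
    fix Z show "\<forall>\<^sub>F M in sequentially. Z \<le> 2 * M + 1 - nat (int M - k)"
      using eventually_ge_at_top[of "Z + nat \<bar>k\<bar>"] by eventually_elim auto
  qed
  have f3: "filterlim (\<lambda>M. 2 * M + 1) at_top sequentially"
    unfolding filterlim_at_top
  proof
    fix Z show "\<forall>\<^sub>F M in sequentially. Z \<le> 2 * M + 1"
      using eventually_ge_at_top[of Z] by eventually_elim auto
  qed
  have "(\<lambda>M. qpoch Q Q (2*M+1) / (qpoch Q Q (nat (int M - k)) * qpoch Q Q (2*M+1 - nat (int M - k))))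
     \<longlonglongrightarrow> qpoch_inf Q Q / (qpoch_inf Q Q * qpoch_inf Q Q)"
    using nzi by (intro tendsto_intros lim f1 f2 f3) auto
  moreover have "\<forall>\<^sub>F M in sequentially. qpoch Q Q (2*M+1) / (qpoch Q Q (nat (int M - k)) * qpoch Q Q (2*M+1 - nat (int M - k)))
      = qbinom Q (2*M+1) (nat (int M - k))"
    using eventually_ge_at_top[of "nat \<bar>k\<bar>"]
    by eventually_elim (auto simp: qbinom_eq_divide[OF nz])
  ultimately show ?thesis using nzi by (simp add: tendsto_cong)
qed

text \<open>The limit \<open>M \<rightarrow> \<infinity>\<close> of the truncated moments, by dominated convergence. The sequence is shifted by \<open>|p div 2|\<close> to
keep the truncated formula valid for all its members.\<close>

lemma theta_weight_moment:
  fixes q :: real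
  assumes q: "0 < q" "q < 1"
  defines "Q \<equiv> complex_of_real q"
  shows "((\<lambda>\<theta>. cis (of_int p * \<theta>) * complex_of_real (theta_weight q \<theta>)) has_integral
     (if odd p then 0 else 2 * of_real pi / qpoch_inf Q Q * (-1) powi (p div 2) * (Q powi tri (p div 2) + Q powi tri (p div 2 + 1)))) {-pi..pi}"
proof -
  obtain B where B: "\<And>N \<theta>. \<bar>theta_weight_trunc q N \<theta>\<bar> \<le> B" using theta_weight_trunc_bounded[OF q] by blast
  have Q: "norm Q < 1" using q by (simp add: Q_def)
  define k where "k = p div 2"
  define y where "y M = (if odd p then 0 else 2 * of_real pi * (-1) powi k * (qbinom Q (2*M+1) (nat (int M - k)) * Q powi tri (k + 1)
         + qbinom Q (2*M+1) (nat (int M + 1 - k)) * Q powi tri k))" for M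
  (* the shift that makes the truncation long enough for the moment of order p *)
  define K where "K = nat \<bar>k\<bar>"
  show ?thesis
  proof (rule has_integral_dominated_convergence)
    fix M
    show "((\<lambda>\<theta>. cis (of_int p * \<theta>) * complex_of_real (theta_weight_trunc q (Suc (M + K)) \<theta>)) has_integral y (M + K)) {-pi..pi}"
    proof (cases "odd p")
      case False
      then have "p = 2 * k" by (auto simp: k_def)
      then show ?thesis using theta_weight_trunc_moment(2)[OF q(1), of k "M + K"] False
        by (simp add: y_def K_def Q_def)
    qed (use theta_weight_trunc_moment(1)[OF q(1), of p "M + K"] in \<open>simp add: y_def\<close>)
    show "\<forall>\<theta>\<in>{-pi..pi}. norm (cis (of_int p * \<theta>) * complex_of_real (theta_weight_trunc q (Suc (M + K)) \<theta>)) \<le> B"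
      using B by (simp add: norm_mult)
  next
    show "(\<lambda>_. B) integrable_on {-pi..pi}" by (rule integrable_const_ivl)
    show "\<forall>\<theta>\<in>{-pi..pi}. (\<lambda>M. cis (of_int p * \<theta>) * complex_of_real (theta_weight_trunc q (Suc (M + K)) \<theta>))
       \<longlonglongrightarrow> cis (of_int p * \<theta>) * complex_of_real (theta_weight q \<theta>)"
    proof
      fix \<theta>
      have "(\<lambda>M. theta_weight_trunc q (M + Suc K) \<theta>) \<longlonglongrightarrow> theta_weight q \<theta>"
        by (rule LIMSEQ_ignore_initial_segment) (rule theta_weight_trunc_tendsto[OF q])
      then show "(\<lambda>M. cis (of_int p * \<theta>) * complex_of_real (theta_weight_trunc q (Suc (M + K)) \<theta>))
       \<longlonglongrightarrow> cis (of_int p * \<theta>) * complex_of_real (theta_weight q \<theta>)"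
        by (intro tendsto_intros) simp
    qed
    have "(\<lambda>M. y M) \<longlonglongrightarrow> (if odd p then 0 else 2 * of_real pi * (-1) powi k *
       (1 / qpoch_inf Q Q * Q powi tri (k + 1) + 1 / qpoch_inf Q Q * Q powi tri k))"
    proof (cases "odd p")
      case False
      have "(\<lambda>M. qbinom Q (2*M+1) (nat (int M + 1 - k))) \<longlonglongrightarrow> 1 / qpoch_inf Q Q"
        using qbinom_central_tendsto[OF Q, of "k - 1"] by (simp add: algebra_simps)
      then show ?thesis using False unfolding y_def if_not_P[OF False]
        by (intro tendsto_intros qbinom_central_tendsto[OF Q])
    qed (simp add: y_def)
    also have "2 * of_real pi * (-1) powi k *
       (1 / qpoch_inf Q Q * Q powi tri (k + 1) + 1 / qpoch_inf Q Q * Q powi tri k)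
       = 2 * of_real pi / qpoch_inf Q Q * (-1) powi k * (Q powi tri k + Q powi tri (k + 1))"
      by (simp add: field_simps add_divide_distrib)
    finally show "(\<lambda>M. y (M + K)) \<longlonglongrightarrow> (if odd p then 0 else 2 * of_real pi / qpoch_inf Q Q * (-1) powi (p div 2) * (Q powi tri (p div 2) + Q powi tri (p div 2 + 1)))"
      unfolding k_def[symmetric] by (rule LIMSEQ_ignore_initial_segment)
  qed
qed

section \<open>Orthogonality of the continuous \<open>q\<close>-Hermite polynomials\<close>

text \<open>This is \<open>H\<^sub>n (cos \<theta> | q)\<close> as a trigonometric polynomial on the whole line, where its parity and its Fourier
coefficients can be used.\<close>

definition hermite_angle :: "real \<Rightarrow> nat \<Rightarrow> real \<Rightarrow> complex" where
  "hermite_angle q n \<theta> = (\<Sum>k\<le>n. qbinom (complex_of_real q) n k * cis (of_int (int n - 2 * int k) * \<theta>))"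

text \<open>If \<open>n + m\<close> is odd, only odd moments of the weight occur, and these vanish. Otherwise the frequency belonging to the indices \<open>k\<close> and \<open>l\<close> is \<open>2 (N - k)\<close> with \<open>N = (n + m) / 2 - l\<close>,
and \<open>0 \<le> N \<le> n\<close> because \<open>l \<le> m \<le> n\<close>. By \<open>sum_qbinom_moments\<close> the sum over \<open>k\<close> vanishes unless \<open>N = 0\<close> or \<open>N = n\<close>, which
requires \<open>m = n\<close> and \<open>l = n\<close> or \<open>l = 0\<close>, respectively.\<close>

lemma hermite_angle_orthogonal_le:
  fixes q :: real
  assumes q: "0 < q" "q < 1" and mn: "m \<le> n"
  defines "Q \<equiv> complex_of_real q"
  shows "((\<lambda>\<theta>. hermite_angle q n \<theta> * hermite_angle q m \<theta> * complex_of_real (theta_weight q \<theta>)) has_integral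
     (if m = n then 4 * of_real pi * qpoch Q Q n / qpoch_inf Q Q else 0)) {-pi..pi}"
proof -
  have Q: "norm Q < 1" "Q \<noteq> 0" using q by (auto simp: Q_def)
  have nz: "qpoch Q Q n \<noteq> 0" for n by (rule qpoch_nonzero[OF Q(1) Q(1)])
  define c where "c = 2 * of_real pi / qpoch_inf Q Q"
  define I where "I p = (if odd p then 0 else c * (-1) powi (p div 2) * (Q powi tri (p div 2) + Q powi tri (p div 2 + 1)))" for p :: int
  define a where "a l k = int n + int m - 2 * int l - 2 * int k" for l k
  have "(\<lambda>\<theta>. hermite_angle q n \<theta> * hermite_angle q m \<theta> * complex_of_real (theta_weight q \<theta>))
     = (\<lambda>\<theta>. \<Sum>l\<le>m. qbinom Q m l * (\<Sum>k\<le>n. qbinom Q n k * (cis (of_int (a l k) * \<theta>) * complex_of_real (theta_weight q \<theta>))))"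
  proof
    fix \<theta>
    have "cis (of_int (a l k) * \<theta>) = cis (of_int (int m - 2 * int l) * \<theta>) * cis (of_int (int n - 2 * int k) * \<theta>)" for l k
      unfolding cis_mult by (rule arg_cong[of _ _ cis]) (simp add: a_def algebra_simps)
    then show "hermite_angle q n \<theta> * hermite_angle q m \<theta> * complex_of_real (theta_weight q \<theta>)
     = (\<Sum>l\<le>m. qbinom Q m l * (\<Sum>k\<le>n. qbinom Q n k * (cis (of_int (a l k) * \<theta>) * complex_of_real (theta_weight q \<theta>))))"
      unfolding hermite_angle_def Q_def[symmetric] by (simp add: sum_distrib_left sum_distrib_right mult_ac)
        (subst sum.swap, simp)
  qed
  then have *: "((\<lambda>\<theta>. hermite_angle q n \<theta> * hermite_angle q m \<theta> * complex_of_real (theta_weight q \<theta>)) has_integral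
     (\<Sum>l\<le>m. qbinom Q m l * (\<Sum>k\<le>n. qbinom Q n k * I (a l k)))) {-pi..pi}"
    unfolding I_def c_def Q_def
    by (simp only:) (intro has_integral_sum has_integral_mult_right theta_weight_moment q finite_atMost)
  have S: "(\<Sum>l\<le>m. qbinom Q m l * (\<Sum>k\<le>n. qbinom Q n k * I (a l k))) = (if m = n then 2 * c * qpoch Q Q n else 0)"
  proof (cases "even (n + m)")
    case False
    then have "I (a l k) = 0" for l k by (auto simp: I_def a_def)
    then show ?thesis using False by auto
  next
    case True
    define h where "h = (n + m) div 2"
    have h: "n + m = 2 * h" using True by (auto simp: h_def)
    have inner: "(\<Sum>k\<le>n. qbinom Q n k * I (a l k)) = c * ((if h - l = 0 then qpoch Q Q n else 0) + (if h - l = n then qpoch Q Q n else 0))"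
      if "l \<le> m" for l
    proof -
      define N where "N = h - l"
      have N: "N \<le> n" "int N = int h - int l" using that mn h by (auto simp: N_def)
      have "I (a l k) = c * (-1) ^ N * ((-1) ^ k * Q powi tri (int N - int k) + (-1) ^ k * Q powi tri (int N - int k + 1))" for k
      proof -
        define i where "i = int N - int k"
        have "a l k = 2 * i" using h N by (simp add: a_def i_def)
        moreover have "(-1) powi i = ((-1) ^ N * (-1) ^ k :: complex)" unfolding i_def
          by (subst power_int_diff) (auto simp: field_simps simp flip: power_mult_distrib)
        ultimately show ?thesis unfolding i_def[symmetric] by (simp add: I_def distrib_left mult_ac)
      qed
      then have "(\<Sum>k\<le>n. qbinom Q n k * I (a l k)) = c * (-1) ^ N *
         ((\<Sum>k\<le>n. qbinom Q n k * (-1) ^ k * Q powi tri (int N - int k)) + (\<Sum>k\<le>n. qbinom Q n k * (-1) ^ k * Q powi tri (int N - int k + 1)))"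
        by (simp add: sum_distrib_left sum.distrib[symmetric] algebra_simps)
      also have "\<dots> = c * ((if N = 0 then qpoch Q Q n else 0) + (if N = n then qpoch Q Q n else 0))"
        unfolding sum_qbinom_moments[OF Q(2) nz N(1)] by (auto simp flip: power_mult_distrib)
      finally show ?thesis unfolding N_def .
    qed
    have "(\<Sum>l\<le>m. qbinom Q m l * (\<Sum>k\<le>n. qbinom Q n k * I (a l k)))
      = (\<Sum>l\<le>m. qbinom Q m l * (c * ((if h - l = 0 then qpoch Q Q n else 0) + (if h - l = n then qpoch Q Q n else 0))))"
      by (intro sum.cong) (auto simp: inner)
    also have "\<dots> = (if m = n then 2 * c * qpoch Q Q n else 0)"
    proof (cases "m = n")
      case True
      then have "h = n" using h by simp
      have "(\<Sum>l\<le>m. qbinom Q m l * (c * ((if h - l = 0 then qpoch Q Q n else 0) + (if h - l = n then qpoch Q Q n else 0))))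
         = (\<Sum>l\<le>n. (if l = n then c * qpoch Q Q n else 0) + (if l = 0 then c * qpoch Q Q n else 0))"
        using True \<open>h = n\<close> by (intro sum.cong) (auto simp: distrib_left)
      also have "\<dots> = 2 * c * qpoch Q Q n"
        by (simp add: sum.distrib)
      finally show ?thesis using True by simp
    next
      case False
      then have "h - l \<noteq> 0" "h - l \<noteq> n" if "l \<le> m" for l using h mn that by auto
      then show ?thesis using False by auto
    qed
    finally show ?thesis .
  qed
  have "2 * c * qpoch Q Q n = 4 * of_real pi * qpoch Q Q n / qpoch_inf Q Q" by (simp add: c_def)
  from *[unfolded S this] show ?thesis .
qed

lemma hermite_angle_orthogonal:
  fixes q :: real
  assumes q: "0 < q" "q < 1"
  defines "Q \<equiv> complex_of_real q"
  shows "((\<lambda>\<theta>. hermite_angle q n \<theta> * hermite_angle q m \<theta> * complex_of_real (theta_weight q \<theta>)) has_integral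
     (if m = n then 4 * of_real pi * qpoch Q Q n / qpoch_inf Q Q else 0)) {-pi..pi}"
proof (cases "m \<le> n")
  case True
  then show ?thesis unfolding Q_def by (rule hermite_angle_orthogonal_le[OF q])
next
  case False
  then show ?thesis using hermite_angle_orthogonal_le[OF q, of n m] unfolding Q_def
    by (simp add: mult.commute[of "hermite_angle q n _"])
qed

text \<open>The symmetry \<open>k \<mapsto> n - k\<close> of the coefficients; it also makes the values real.\<close>

lemma hermite_angle_minus: "hermite_angle q n (- \<theta>) = hermite_angle q n \<theta>" if "0 < q" "q < 1"
proof -
  have "norm (complex_of_real q) < 1" using that by simp
  then have nz: "qpoch (complex_of_real q) (complex_of_real q) n \<noteq> 0" for n by (intro qpoch_nonzero)
  show ?thesis unfolding hermite_angle_def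
    by (rule sum.reindex_bij_witness[where i = "\<lambda>k. n - k" and j = "\<lambda>k. n - k"])
       (auto simp: qbinom_eq_divide[OF nz] of_nat_diff algebra_simps)
qed

lemma cnj_hermite_angle: "cnj (hermite_angle q n \<theta>) = hermite_angle q n \<theta>" if "0 < q" "q < 1"
proof -
  have "cnj (qbinom (complex_of_real q) n k) = qbinom (complex_of_real q) n k" for n k
    by (induction "complex_of_real q" n k rule: qbinom.induct) auto
  then have "cnj (hermite_angle q n \<theta>) = hermite_angle q n (- \<theta>)"
    unfolding hermite_angle_def by (simp add: cis_cnj)
  then show ?thesis by (simp add: hermite_angle_minus[OF that])
qed

lemma q_hermite_eq_hermite_angle:
  assumes "0 < q" "q < 1"
  shows "q_hermite q n x = hermite_angle q n (arccos x)"
proof -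
  have "norm (complex_of_real q) < 1" using assms by simp
  then have nz: "qpoch (complex_of_real q) (complex_of_real q) n \<noteq> 0" for n by (intro qpoch_nonzero)
  show ?thesis unfolding q_hermite_def hermite_angle_def
    by (intro sum.cong) (auto simp: qbinom_eq_divide[OF nz] qpoch_of_real)
qed

section \<open>Orthonormality on the interval\<close>

lemma qpoch_inf_pos:
  fixes q :: real
  assumes "0 < q" "q < 1"
  shows "qpoch_inf q q > 0"
proof -
  have "qpoch_inf q q \<ge> 0"
    using qpoch_pos[OF assms] by (intro LIMSEQ_le_const[OF qpoch_tendsto_qpoch_inf(1)]) (use assms less_imp_le in auto)
  moreover have "qpoch_inf q q \<noteq> 0" by (rule qpoch_inf_nonzero) (use assms in auto)
  ultimately show ?thesis by simp
qed

lemma qpoch_inf_of_real: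
  fixes q :: real
  assumes "0 < q" "q < 1"
  shows "qpoch_inf (complex_of_real q) (complex_of_real q) = complex_of_real (qpoch_inf q q)"
proof (rule LIMSEQ_unique)
  show "qpoch (complex_of_real q) (complex_of_real q) \<longlonglongrightarrow> qpoch_inf (complex_of_real q) (complex_of_real q)"
    by (rule qpoch_tendsto_qpoch_inf) (use assms in auto)
  have "(\<lambda>n. complex_of_real (qpoch q q n)) \<longlonglongrightarrow> complex_of_real (qpoch_inf q q)"
    by (intro tendsto_of_real qpoch_tendsto_qpoch_inf) (use assms in auto)
  then show "qpoch (complex_of_real q) (complex_of_real q) \<longlonglongrightarrow> complex_of_real (qpoch_inf q q)"
    by (simp add: qpoch_of_real[symmetric])
qed

text \<open>The product in the weight without its factor \<open>2 + c\<close> at \<open>k = 0\<close>, which cancels the singularity of the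
inverse square root.\<close>

definition tail_weight :: "real \<Rightarrow> real \<Rightarrow> real" where
  "tail_weight q c = (\<Prod>k. 1 + c * (q * q ^ k) + (q * q ^ k)\<^sup>2)"

lemma prodinf_split_head_weight:
  fixes q c :: real
  assumes q: "0 < q" "q < 1"
  shows "(\<Prod>k. 1 + c * q ^ k + q ^ (2 * k)) = (2 + c) * tail_weight q c"
proof (rule LIMSEQ_unique)
  have e: "1 + c * q ^ k + q ^ (2 * k) = 1 + c * (1 * q ^ k) + (1 * q ^ k)\<^sup>2" for k
    by (simp add: mult.commute[of 2 k] power_mult)
  have "(\<lambda>N. \<Prod>k<Suc N. 1 + c * q ^ k + q ^ (2 * k)) \<longlonglongrightarrow> (\<Prod>k. 1 + c * q ^ k + q ^ (2 * k))"
    unfolding e by (rule LIMSEQ_Suc) (rule tendsto_prodinf_quadratic_factors[OF q])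
  then show "(\<lambda>N. (2 + c) * (\<Prod>k<N. 1 + c * (q * q ^ k) + (q * q ^ k)\<^sup>2)) \<longlonglongrightarrow> (\<Prod>k. 1 + c * q ^ k + q ^ (2 * k))"
    unfolding e by (simp add: prod.lessThan_Suc_shift del: prod.lessThan_Suc)
  show "(\<lambda>N. (2 + c) * (\<Prod>k<N. 1 + c * (q * q ^ k) + (q * q ^ k)\<^sup>2)) \<longlonglongrightarrow> (2 + c) * tail_weight q c"
    unfolding tail_weight_def by (intro tendsto_intros tendsto_prodinf_quadratic_factors q)
qed

lemma tail_weight_nonneg:
  assumes q: "0 < q" "q < 1" and c: "\<bar>c\<bar> \<le> 2"
  shows "0 \<le> tail_weight q c"
  unfolding tail_weight_def
  by (rule quadratic_factors_bounded[of q q], (use q in simp_all)[3])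
     (intro LIMSEQ_le_const[OF tendsto_prodinf_quadratic_factors[OF q]], use c in blast)

definition half_width :: "real \<Rightarrow> real" where "half_width q = sqrt 2 / sqrt (1 - q)"

lemma q_interval_eq: "q_interval q = {- half_width q<..<half_width q}"
  by (simp add: q_interval_def half_width_def)

lemma half_width_pos: "q < 1 \<Longrightarrow> 0 < half_width q"
  by (simp add: half_width_def)

lemma square_bounds: "0 \<le> 1 - x\<^sup>2" "\<bar>2 - 4 * x\<^sup>2\<bar> \<le> 2" if "x \<in> {-1..1::real}" for x
proof -
  have "x\<^sup>2 \<le> 1" using that by (simp add: abs_square_le_1 abs_le_iff)
  then show "0 \<le> 1 - x\<^sup>2" "\<bar>2 - 4 * x\<^sup>2\<bar> \<le> 2" using zero_le_power2[of x] by (simp_all add: abs_le_iff)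
qed

text \<open>The factor at \<open>k = 0\<close> is \<open>4 (1 - x\<^sup>2)\<close>. The equation holds at the end points \<open>x = 1\<close> and \<open>x = -1\<close> as well, where the left-hand
side is a quotient by zero; thus the weight is continuous on the closed interval.\<close>

lemma q_weight_eq_tail_weight:
  assumes q: "0 < q" "q < 1" and x: "x \<in> {-1..1}"
  shows "q_weight q (sqrt 2 * (half_width q * x)) =
    qpoch_inf q q * sqrt (1 - q) / pi * sqrt (1 - x\<^sup>2) * tail_weight q (2 - 4 * x\<^sup>2)"
proof -
  have u: "(sqrt 2 * (half_width q * x))\<^sup>2 * (1 - q) = 4 * x\<^sup>2"
    using q by (simp add: half_width_def power_mult_distrib power_divide)
  then have u': "(1 - q) * (sqrt 2 * (half_width q * x))\<^sup>2 = 4 * x\<^sup>2" by (simp add: mult.commute)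
  have s: "(1 - x\<^sup>2) / sqrt (1 - x\<^sup>2) = sqrt (1 - x\<^sup>2)" by (rule real_div_sqrt[OF square_bounds(1)[OF x]])
  have e: "2 + (2 - 4 * x\<^sup>2) = 4 * (1 - x\<^sup>2)" and "4 * x\<^sup>2 / 4 = x\<^sup>2" by simp_all
  have "a / (4 * pi * S) * ((4 * y) * V) = a / pi * (y / S) * V" for a S V y :: real
    by simp
  then show ?thesis
    unfolding q_weight_def u u' prodinf_split_head_weight[OF q] e \<open>4 * x\<^sup>2 / 4 = x\<^sup>2\<close> by (simp only: s)
qed

text \<open>The function \<open>sqrt 2 \<omega>\<^sub>q (sqrt 2 \<xi>)\<close> in the variable \<open>x = \<xi> / half_width q\<close>.\<close>

definition scaled_q_weight :: "real \<Rightarrow> real \<Rightarrow> real" where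
  "scaled_q_weight q x = sqrt 2 * (qpoch_inf q q * sqrt (1 - q) / pi * sqrt (1 - x\<^sup>2) * tail_weight q (2 - 4 * x\<^sup>2))"

lemma q_fun_eq:
  assumes q: "0 < q" "q < 1" and x: "x \<in> {-1..1}"
  shows "q_fun q j (half_width q * x) = complex_of_real (sqrt (scaled_q_weight q x / qpoch q q j)) * hermite_angle q j (arccos x)"
proof -
  have "sqrt ((1 - q) / 2) * (half_width q * x) = x"
    using q by (simp add: half_width_def real_sqrt_divide)
  then show ?thesis
    by (simp only: q_fun_def q_weight_eq_tail_weight[OF q x] scaled_q_weight_def q_hermite_eq_hermite_angle[OF q])
qed

lemma scaled_q_weight_nonneg:
  assumes q: "0 < q" "q < 1" and x: "x \<in> {-1..1}"
  shows "0 \<le> scaled_q_weight q x"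
  unfolding scaled_q_weight_def using tail_weight_nonneg[OF q square_bounds(2)[OF x]] qpoch_inf_pos[OF q] q square_bounds(1)[OF x]
  by (intro mult_nonneg_nonneg divide_nonneg_nonneg) auto

lemma continuous_on_scaled_q_weight:
  assumes q: "0 < q" "q < 1"
  shows "continuous_on {-1..1} (scaled_q_weight q)"
proof -
  have "continuous_on {-2..2} (tail_weight q)"
    using continuous_on_prodinf_quadratic_factors[OF q, of q] q by (simp add: tail_weight_def[abs_def])
  then have "continuous_on {-1..1} (\<lambda>x. tail_weight q (2 - 4 * x\<^sup>2))"
    by (rule continuous_on_compose2) (use square_bounds(2) in \<open>force intro!: continuous_intros simp: abs_le_iff\<close>)+
  then show ?thesis unfolding scaled_q_weight_def[abs_def] by (intro continuous_intros) auto
qed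

lemma scaled_interval: "(\<lambda>\<xi>. \<xi> / half_width q) ` {- half_width q..half_width q} \<subseteq> {-1..1}" if "q < 1"
  using half_width_pos[OF that] by (auto simp: field_simps)

lemma continuous_on_q_fun:
  assumes q: "0 < q" "q < 1"
  shows "continuous_on {- half_width q..half_width q} (q_fun q j)"
proof -
  have "continuous_on UNIV (hermite_angle q j)"
    unfolding hermite_angle_def[abs_def] by (intro continuous_intros)
  then have "continuous_on {-1..1} (\<lambda>x. complex_of_real (sqrt (scaled_q_weight q x / qpoch q q j)) * hermite_angle q j (arccos x))"
    using qpoch_pos[OF q, of j]
    by (intro continuous_intros continuous_on_scaled_q_weight q continuous_on_arccos' continuous_on_compose2[where g = "hermite_angle q j" and f = arccos]) auto
  then have "continuous_on {- half_width q..half_width q} (\<lambda>\<xi>. complex_of_real (sqrt (scaled_q_weight q (\<xi> / half_width q) / qpoch q q j)) * hermite_angle q j (arccos (\<xi> / half_width q)))"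
    by (rule continuous_on_compose2) (use scaled_interval[OF q(2)] half_width_pos[OF q(2)] in \<open>auto intro!: continuous_intros\<close>)
  also have "?this \<longleftrightarrow> ?thesis"
  proof (intro continuous_on_cong refl)
    fix \<xi> assume "\<xi> \<in> {- half_width q..half_width q}"
    then have "\<xi> / half_width q \<in> {-1..1}" using scaled_interval[OF q(2)] by blast
    from q_fun_eq[OF q this, of j] show "complex_of_real (sqrt (scaled_q_weight q (\<xi> / half_width q) / qpoch q q j)) * hermite_angle q j (arccos (\<xi> / half_width q)) = q_fun q j \<xi>"
      using half_width_pos[OF q(2)] by simp
  qed
  finally show ?thesis .
qed

text \<open>A sum of \<open>n + 1\<close> terms with bounded coefficients, since \<open>(q)\<^sub>n \<le> 1\<close> and \<open>1 / (q)\<^sub>n\<close> is bounded.\<close>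

lemma norm_hermite_angle_le:
  assumes q: "0 < q" "q < 1"
  obtains B where "B > 0" "\<And>n \<theta>. norm (hermite_angle q n \<theta>) \<le> B * (real n + 1)"
proof -
  define Q where "Q = complex_of_real q"
  have Q: "norm Q < 1" using q by (simp add: Q_def)
  have nz: "qpoch Q Q n \<noteq> 0" for n by (rule qpoch_nonzero[OF Q Q])
  obtain B where B: "B > 0" "\<And>n. norm (1 / qpoch Q Q n) \<le> B" using bounded_inverse_qpoch[OF Q] by blast
  have le1: "norm (qpoch Q Q n) \<le> 1" for n
    using qpoch_le_1[OF q, of n] qpoch_pos[OF q, of n] unfolding Q_def qpoch_of_real by simp
  have "norm (hermite_angle q n \<theta>) \<le> (B * B) * (real n + 1)" for n \<theta>
  proof -
    have "norm (hermite_angle q n \<theta>) \<le> (\<Sum>k\<le>n. B * B)"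
      unfolding hermite_angle_def Q_def[symmetric]
    proof (rule sum_norm_le)
      fix k assume "k \<in> {..n}"
      then have "norm (qbinom Q n k * cis (of_int (int n - 2 * int k) * \<theta>))
         = norm (qpoch Q Q n) * (norm (1 / qpoch Q Q k) * norm (1 / qpoch Q Q (n - k)))"
        by (simp add: qbinom_eq_divide[OF nz] norm_mult norm_divide)
      also have "\<dots> \<le> 1 * (B * B)" using B le1 by (intro mult_mono) auto
      finally show "norm (qbinom Q n k * cis (of_int (int n - 2 * int k) * \<theta>)) \<le> B * B" by simp
    qed
    then show ?thesis by (simp add: algebra_simps)
  qed
  then show ?thesis using that[of "B * B"] B(1) by simp
qed

lemma norm_q_fun_le:
  assumes q: "0 < q" "q < 1"
  obtains C where "C \<ge> 0" "\<And>j \<xi>. \<xi> \<in> {- half_width q..half_width q} \<Longrightarrow> norm (q_fun q j \<xi>) \<le> C * (real j + 1)"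
proof -
  obtain B where B: "B > 0" "\<And>n \<theta>. norm (hermite_angle q n \<theta>) \<le> B * (real n + 1)" using norm_hermite_angle_le[OF q] by blast
  obtain D where D: "D > 0" "\<And>n. norm (1 / qpoch q q n) \<le> D" using bounded_inverse_qpoch[of q] q by auto
  have "compact (scaled_q_weight q ` {-1..1})" by (intro compact_continuous_image continuous_on_scaled_q_weight q) auto
  then have "bounded (scaled_q_weight q ` {-1..1})" by (rule compact_imp_bounded)
  then obtain W where "\<forall>y\<in>scaled_q_weight q ` {-1..1}. norm y \<le> W" unfolding bounded_iff by blast
  then have W: "\<And>x. x \<in> {-1..1} \<Longrightarrow> \<bar>scaled_q_weight q x\<bar> \<le> W" by simp
  have W0: "0 \<le> W" using W[of 0] by simp
  have "norm (q_fun q j \<xi>) \<le> (sqrt (W * D) * B) * (real j + 1)" if \<xi>: "\<xi> \<in> {- half_width q..half_width q}" for j \<xi>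
  proof -
    define x where "x = \<xi> / half_width q"
    have x: "x \<in> {-1..1}" "\<xi> = half_width q * x"
      using scaled_interval[OF q(2)] \<xi> half_width_pos[OF q(2)] unfolding x_def by (blast, simp)
    have "scaled_q_weight q x / qpoch q q j = scaled_q_weight q x * (1 / qpoch q q j)" by simp
    also have "\<dots> \<le> W * D"
      using W[OF x(1)] D(2)[of j] W0 qpoch_pos[OF q, of j] by (intro mult_mono) auto
    finally have w: "sqrt (scaled_q_weight q x / qpoch q q j) \<le> sqrt (W * D)" by simp
    have "norm (q_fun q j \<xi>) = sqrt (scaled_q_weight q x / qpoch q q j) * norm (hermite_angle q j (arccos x))"
      using scaled_q_weight_nonneg[OF q x(1)] qpoch_pos[OF q, of j] unfolding x(2) q_fun_eq[OF q x(1)] by (simp add: norm_mult)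
    also have "\<dots> \<le> sqrt (W * D) * (B * (real j + 1))"
      using w B W0 D(1) by (intro mult_mono) auto
    finally show ?thesis by simp
  qed
  moreover have "0 \<le> sqrt (W * D) * B" using W0 D(1) B(1) by simp
  ultimately show ?thesis using that by blast
qed

text \<open>The substitution \<open>\<xi> = half_width q * cos \<theta>\<close> absorbs the square root in the weight into \<open>sin\<^sup>2 \<theta>\<close>, a quarter of the factor of
\<open>theta_weight\<close> at \<open>k = 0\<close>. The integral over \<open>[0, \<pi>]\<close> is half of that over \<open>[-\<pi>, \<pi>]\<close> because the integrand is even.\<close>

lemma q_fun_orthonormal:
  assumes q: "0 < q" "q < 1"
  shows "integral {- half_width q..half_width q} (\<lambda>\<xi>. q_fun q j \<xi> * cnj (q_fun q k \<xi>)) = (if j = k then 1 else 0)"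
proof -
  define F where "F \<xi> = q_fun q j \<xi> * cnj (q_fun q k \<xi>)" for \<xi>
  define G where "G \<theta> = hermite_angle q j \<theta> * hermite_angle q k \<theta> * complex_of_real (theta_weight q \<theta>)" for \<theta>
  define T where "T = (if k = j then 4 * complex_of_real pi * complex_of_real (qpoch q q j) / complex_of_real (qpoch_inf q q) else 0)"
  define K where "K = complex_of_real (qpoch_inf q q / (2 * pi) / sqrt (qpoch q q j * qpoch q q k))"
  have r: "0 < half_width q" using half_width_pos q by blast
  have cF: "continuous_on {- half_width q..half_width q} F" unfolding F_def[abs_def]
    by (intro continuous_intros continuous_on_q_fun q)
  have G: "(G has_integral T) {-pi..pi}"
    using hermite_angle_orthogonal[OF q, of j k] unfolding G_def[abs_def] T_def qpoch_of_real qpoch_inf_of_real[OF q] .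
  have Gm: "G (- \<theta>) = G \<theta>" for \<theta> by (simp add: G_def hermite_angle_minus[OF q] theta_weight_def)
  have Gi: "G integrable_on {0..pi}" "G integrable_on {-pi..0}"
    using integrable_subinterval_real[OF has_integral_integrable[OF G]] by auto
  have "integral {-pi..0} G = integral {0..pi} G"
    using has_integral_reflect_real[where f = G and i = "integral {0..pi} G" and b = pi and a = 0] Gi(1) by (simp add: Gm integral_unique integrable_integral)
  moreover have "integral {-pi..0} G + integral {0..pi} G = T"
    using Henstock_Kurzweil_Integration.integral_combine[where f = G and a = "-pi" and b = pi and c = 0] has_integral_integrable[OF G] integral_unique[OF G] by simp
  ultimately have half: "integral {0..pi} G = T / 2" by (simp add: field_simps)
  (* the substitution reverses the orientation, whence the sign and the difference of two integrals,
     the first of which is over an empty interval *)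
  have "((\<lambda>\<theta>. (- half_width q * sin \<theta>) *\<^sub>R F (half_width q * cos \<theta>)) has_integral
     (integral {half_width q * cos 0..half_width q * cos pi} F - integral {half_width q * cos pi..half_width q * cos 0} F)) {0..pi}"
  proof (rule has_integral_substitution_general[where s = "{}" and c = "- half_width q" and d = "half_width q"])
    show "(\<lambda>\<theta>. half_width q * cos \<theta>) ` {0..pi} \<subseteq> {- half_width q..half_width q}"
      using r by (auto simp: mult_le_cancel_left1) (metis cos_ge_minus_one mult.commute mult_minus1 mult_right_mono less_imp_le)
  qed (use cF in \<open>auto intro!: continuous_intros derivative_eq_intros\<close>)
  also have "integral {half_width q * cos 0..half_width q * cos pi} F = 0" using r by simp
  finally have "((\<lambda>\<theta>. - ((- half_width q * sin \<theta>) *\<^sub>R F (half_width q * cos \<theta>))) has_integral - (0 - integral {- half_width q..half_width q} F)) {0..pi}"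
    by (intro has_integral_neg) simp
  moreover have "- ((- half_width q * sin \<theta>) *\<^sub>R F (half_width q * cos \<theta>)) = K * G \<theta>" if \<theta>: "\<theta> \<in> {0..pi}" for \<theta>
  proof -
    have x: "cos \<theta> \<in> {-1..1}" by simp
    have ac: "arccos (cos \<theta>) = \<theta>" using \<theta> by (intro arccos_cos) auto
    define w where "w = scaled_q_weight q (cos \<theta>)"
    have w0: "0 \<le> w" unfolding w_def by (rule scaled_q_weight_nonneg[OF q x])
    have sin: "sqrt (1 - (cos \<theta>)\<^sup>2) = sin \<theta>"
      using \<theta> sin_ge_zero[of \<theta>] by (simp add: cos_squared_eq)
    have c2: "2 - 4 * (cos \<theta>)\<^sup>2 = - 2 * cos (2 * \<theta>)" by (simp add: cos_double_cos)
    have s2: "2 + (- 2 * cos (2 * \<theta>)) = 4 * (sin \<theta>)\<^sup>2" by (simp add: cos_double_sin)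
    have tw: "theta_weight q \<theta> = 4 * (sin \<theta>)\<^sup>2 * tail_weight q (2 - 4 * (cos \<theta>)\<^sup>2)"
      unfolding theta_weight_def prodinf_split_head_weight[OF q] s2 c2 ..
    have rs: "half_width q * (sqrt 2 * sqrt (1 - q)) = 2" using q by (simp add: half_width_def)
    have "half_width q * sin \<theta> * w = (half_width q * (sqrt 2 * sqrt (1 - q))) * (qpoch_inf q q / pi * (sin \<theta>)\<^sup>2 * tail_weight q (2 - 4 * (cos \<theta>)\<^sup>2))"
      unfolding w_def scaled_q_weight_def sin by (simp add: power2_eq_square)
    also have "\<dots> = qpoch_inf q q / (2 * pi) * theta_weight q \<theta>" unfolding rs tw by simp
    finally have rw: "half_width q * sin \<theta> * w = qpoch_inf q q / (2 * pi) * theta_weight q \<theta>" .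
    have ss: "sqrt (w / qpoch q q j) * sqrt (w / qpoch q q k) = w / sqrt (qpoch q q j * qpoch q q k)"
      using w0 by (simp add: real_sqrt_divide real_sqrt_mult)
    have "F (half_width q * cos \<theta>) = complex_of_real (sqrt (w / qpoch q q j) * sqrt (w / qpoch q q k)) * (hermite_angle q j \<theta> * hermite_angle q k \<theta>)"
      unfolding F_def q_fun_eq[OF q x] ac w_def[symmetric] by (simp add: cnj_hermite_angle[OF q])
    then have "- ((- half_width q * sin \<theta>) *\<^sub>R F (half_width q * cos \<theta>)) = complex_of_real (half_width q * sin \<theta> * w / sqrt (qpoch q q j * qpoch q q k)) * (hermite_angle q j \<theta> * hermite_angle q k \<theta>)"
      unfolding ss by (simp add: scaleR_conv_of_real)
    also have "\<dots> = K * G \<theta>"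
      unfolding rw by (simp add: K_def G_def)
    finally show ?thesis .
  qed
  ultimately have "((\<lambda>\<theta>. K * G \<theta>) has_integral integral {- half_width q..half_width q} F) {0..pi}"
    by (subst has_integral_cong[symmetric]) auto
  moreover have "((\<lambda>\<theta>. K * G \<theta>) has_integral K * (T / 2)) {0..pi}"
    using Gi half by (intro has_integral_mult_right) (simp add: has_integral_iff)
  ultimately have "integral {- half_width q..half_width q} F = K * (T / 2)" by (rule has_integral_unique)
  also have "\<dots> = (if j = k then 1 else 0)"
    using qpoch_inf_pos[OF q] qpoch_pos[OF q, of j] qpoch_pos[OF q, of k] by (simp add: K_def T_def)
  finally show ?thesis unfolding F_def[abs_def] .
qed

section \<open>Series of continuous functions\<close>

lemma set_integrable_lborel_continuous:
  fixes f :: "real \<Rightarrow> 'a::{banach, second_countable_topology}"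
  assumes "continuous_on {a..b} f"
  shows "set_integrable lborel {a<..<b} f"
proof (rule set_integrable_subset)
  show "set_integrable lborel {a..b} f"
    unfolding set_integrable_def by (rule borel_integrable_compact) (use assms in auto)
qed auto

lemma LBINT_open_interval_continuous:
  fixes f :: "real \<Rightarrow> 'a::euclidean_space"
  assumes "continuous_on {a..b} f"
  shows "(LBINT x:{a<..<b}. f x) = integral {a..b} f"
  using set_borel_integral_eq_integral(2)[OF set_integrable_lborel_continuous[OF assms]]
  by (simp add: integral_open_interval_real)

lemma dominated_series:
  fixes f :: "nat \<Rightarrow> 'b::topological_space \<Rightarrow> complex"
  assumes c: "\<And>j. continuous_on S (f j)" and M: "\<And>j x. x \<in> S \<Longrightarrow> norm (f j x) \<le> M j" and s: "summable M"
  shows "continuous_on S (\<lambda>x. \<Sum>j. f j x)"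
    and "x \<in> S \<Longrightarrow> (\<lambda>j. f j x) sums (\<Sum>j. f j x)"
    and "x \<in> S \<Longrightarrow> norm (\<Sum>j<n. f j x) \<le> suminf M"
    and "x \<in> S \<Longrightarrow> norm (\<Sum>j. f j x) \<le> suminf M"
proof -
  have ul: "uniform_limit S (\<lambda>n x. \<Sum>j<n. f j x) (\<lambda>x. \<Sum>j. f j x) sequentially"
    by (rule Weierstrass_m_test[OF M s])
  show "continuous_on S (\<lambda>x. \<Sum>j. f j x)"
    by (rule uniform_limit_theorem[OF _ ul]) (auto intro!: always_eventually continuous_intros c)
  assume x: "x \<in> S"
  have sn: "summable (\<lambda>j. norm (f j x))"
    by (rule summable_comparison_test[OF _ s]) (use M[OF x] in auto)
  show sm: "(\<lambda>j. f j x) sums (\<Sum>j. f j x)"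
    by (rule summable_sums[OF summable_norm_cancel[OF sn]])
  have M0: "0 \<le> M j" for j using norm_ge_zero[of "f j x"] M[OF x, of j] by linarith
  have b: "norm (\<Sum>j<n. f j x) \<le> suminf M" for n
  proof -
    have "norm (\<Sum>j<n. f j x) \<le> (\<Sum>j<n. M j)" by (rule sum_norm_le) (rule M[OF x])
    also have "\<dots> \<le> suminf M" by (rule sum_le_suminf[OF s]) (auto simp: M0)
    finally show ?thesis .
  qed
  then show "norm (\<Sum>j<n. f j x) \<le> suminf M" .
  show "norm (\<Sum>j. f j x) \<le> suminf M"
    by (rule LIMSEQ_le_const2[OF tendsto_norm[OF sm[unfolded sums_def]]]) (use b in auto)
qed

lemma has_L2_sum_dominated:
  fixes f :: "nat \<Rightarrow> real \<Rightarrow> complex"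
  assumes c: "\<And>j. continuous_on {a..b} (f j)" and M: "\<And>j x. x \<in> {a..b} \<Longrightarrow> norm (f j x) \<le> M j" and s: "summable M"
  shows "has_L2_sum {a<..<b} f (\<lambda>x. \<Sum>j. f j x)"
proof -
  define g where "g x = (\<Sum>j. f j x)" for x
  have cg: "continuous_on {a..b} g"
    unfolding g_def[abs_def] by (rule dominated_series(1)[of _ f M]) (use c M s in auto)
  have U2: "(\<lambda>j. f j x) sums g x" if "x \<in> {a..b}" for x
    unfolding g_def using that by (intro dominated_series(2)[of "{a..b}" f M]) (use c M s in auto)
  have U3: "norm (\<Sum>j<n. f j x) \<le> suminf M" if "x \<in> {a..b}" for x n
    using that by (intro dominated_series(3)[of "{a..b}" f M]) (use c M s in auto)
  have U4: "norm (g x) \<le> suminf M" if "x \<in> {a..b}" for x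
    unfolding g_def using that by (intro dominated_series(4)[of "{a..b}" f M]) (use c M s in auto)
  have cd: "continuous_on {a..b} (\<lambda>x. (cmod (g x - (\<Sum>j<n. f j x)))\<^sup>2)" for n
    by (intro continuous_intros cg c)
  have "(\<lambda>n. integral {a..b} (\<lambda>x. (cmod (g x - (\<Sum>j<n. f j x)))\<^sup>2)) \<longlonglongrightarrow> integral {a..b} (\<lambda>x. 0)"
  proof (rule dominated_convergence)
    show "(\<lambda>x. (cmod (g x - (\<Sum>j<n. f j x)))\<^sup>2) integrable_on {a..b}" for n
      by (rule integrable_continuous_interval[OF cd])
    show "(\<lambda>x. (suminf M + suminf M)\<^sup>2) integrable_on {a..b}" by (rule integrable_const_ivl)
    fix n x assume x: "x \<in> {a..b}"
    have "cmod (g x - (\<Sum>j<n. f j x)) \<le> suminf M + suminf M"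
      using norm_triangle_ineq4[of "g x" "\<Sum>j<n. f j x"] U3[OF x, of n] U4[OF x] by linarith
    then have "(cmod (g x - (\<Sum>j<n. f j x)))\<^sup>2 \<le> (suminf M + suminf M)\<^sup>2"
      by (rule power_mono) simp
    then show "norm ((cmod (g x - (\<Sum>j<n. f j x)))\<^sup>2) \<le> (suminf M + suminf M)\<^sup>2"
      by (simp only: real_norm_def abs_power2)
  next
    fix x assume x: "x \<in> {a..b}"
    have "(\<lambda>n. \<Sum>j<n. f j x) \<longlonglongrightarrow> g x" using U2[OF x] by (simp add: sums_def)
    then have "(\<lambda>n. (cmod (g x - (\<Sum>j<n. f j x)))\<^sup>2) \<longlonglongrightarrow> (cmod (g x - g x))\<^sup>2"
      by (intro tendsto_intros)
    then show "(\<lambda>n. (cmod (g x - (\<Sum>j<n. f j x)))\<^sup>2) \<longlonglongrightarrow> 0" by simp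
  qed
  then have "(\<lambda>n. LBINT x:{a<..<b}. (cmod (g x - (\<Sum>j<n. f j x)))\<^sup>2) \<longlonglongrightarrow> 0"
    unfolding LBINT_open_interval_continuous[OF cd] by simp
  moreover have "set_borel_measurable lborel {a<..<b} g"
    using set_integrable_lborel_continuous[OF cg]
    unfolding set_integrable_def set_borel_measurable_def by (rule borel_measurable_integrable)
  ultimately show ?thesis
    unfolding has_L2_sum_def g_def[symmetric] using set_integrable_lborel_continuous[OF cd] by blast
qed

text \<open>For partial sums the inner product is exact by orthonormality; the integrands converge boundedly on a bounded
interval.\<close>

lemma inner_product_sums:
  fixes c d :: "nat \<Rightarrow> complex" and e :: "nat \<Rightarrow> real \<Rightarrow> complex"
  assumes ce: "\<And>j. continuous_on {a..b} (e j)" and E: "\<And>j x. x \<in> {a..b} \<Longrightarrow> norm (e j x) \<le> E j"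
    and on: "\<And>j k. integral {a..b} (\<lambda>x. e j x * cnj (e k x)) = (if j = k then 1 else 0)"
    and sc: "summable (\<lambda>j. norm (c j) * E j)" and sd: "summable (\<lambda>j. norm (d j) * E j)"
  shows "(\<lambda>j. c j * cnj (d j)) sums
    (LBINT x:{a<..<b}. (\<Sum>j. c j * e j x) * cnj (\<Sum>j. d j * e j x))"
proof -
  define f g where "f x = (\<Sum>j. c j * e j x)" and "g x = (\<Sum>j. d j * e j x)" for x
  have U: "continuous_on {a..b} (\<lambda>x. \<Sum>j. c j * e j x)"
    "x \<in> {a..b} \<Longrightarrow> (\<lambda>j. c j * e j x) sums (\<Sum>j. c j * e j x)"
    "x \<in> {a..b} \<Longrightarrow> norm (\<Sum>j<n. c j * e j x) \<le> (\<Sum>j. norm (c j) * E j)"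
    if s: "summable (\<lambda>j. norm (c j) * E j)" for c x n
  proof -
    have 1: "continuous_on {a..b} (\<lambda>x. c j * e j x)" for j by (intro continuous_intros ce)
    have 2: "norm (c j * e j x) \<le> norm (c j) * E j" if "x \<in> {a..b}" for j x
      using E[OF that, of j] by (simp add: norm_mult mult_left_mono)
    show "continuous_on {a..b} (\<lambda>x. \<Sum>j. c j * e j x)"
      by (rule dominated_series(1)[OF 1 2 s])
    show "(\<lambda>j. c j * e j x) sums (\<Sum>j. c j * e j x)" if "x \<in> {a..b}"
      by (rule dominated_series(2)[OF 1 2 s that])
    show "norm (\<Sum>j<n. c j * e j x) \<le> (\<Sum>j. norm (c j) * E j)" if "x \<in> {a..b}"
      by (rule dominated_series(3)[OF 1 2 s that])
  qed
  note Uf = U[OF sc, folded f_def] and Ug = U[OF sd, folded g_def]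
  have int: "((\<lambda>x. (\<Sum>j<n. c j * e j x) * cnj (\<Sum>k<n. d k * e k x)) has_integral (\<Sum>j<n. c j * cnj (d j))) {a..b}" for n
  proof -
    have "((\<lambda>x. \<Sum>j<n. \<Sum>k<n. (c j * cnj (d k)) * (e j x * cnj (e k x))) has_integral
       (\<Sum>j<n. \<Sum>k<n. (c j * cnj (d k)) * (if j = k then 1 else 0))) {a..b}"
    proof (intro has_integral_sum has_integral_mult_right finite_lessThan)
      fix j k
      have "(\<lambda>x. e j x * cnj (e k x)) integrable_on {a..b}"
        by (intro integrable_continuous_interval continuous_intros ce)
      then show "((\<lambda>x. e j x * cnj (e k x)) has_integral (if j = k then 1 else 0)) {a..b}"
        using on[of j k] by (simp add: has_integral_iff)
    qed
    also have "(\<lambda>x. \<Sum>j<n. \<Sum>k<n. (c j * cnj (d k)) * (e j x * cnj (e k x)))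
       = (\<lambda>x. (\<Sum>j<n. c j * e j x) * cnj (\<Sum>k<n. d k * e k x))"
      by (simp add: sum_product mult_ac)
    also have "(\<Sum>j<n. \<Sum>k<n. (c j * cnj (d k)) * (if j = k then 1 else 0)) = (\<Sum>j<n. c j * cnj (d j))"
      by (intro sum.cong refl) (auto simp: if_distrib cong: if_cong)
    finally show ?thesis .
  qed
  have cfg: "continuous_on {a..b} (\<lambda>x. f x * cnj (g x))"
    unfolding f_def g_def by (intro continuous_intros U(1)[OF sc] U(1)[OF sd])
  have "(\<lambda>n. integral {a..b} (\<lambda>x. (\<Sum>j<n. c j * e j x) * cnj (\<Sum>k<n. d k * e k x))) \<longlonglongrightarrow> integral {a..b} (\<lambda>x. f x * cnj (g x))"
  proof (rule dominated_convergence)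
    show "(\<lambda>x. (\<Sum>j<n. c j * e j x) * cnj (\<Sum>k<n. d k * e k x)) integrable_on {a..b}" for n
      using int by blast
    show "(\<lambda>x. (\<Sum>j. norm (c j) * E j) * (\<Sum>j. norm (d j) * E j)) integrable_on {a..b}" by (rule integrable_const_ivl)
    fix n x assume x: "x \<in> {a..b}"
    show "norm ((\<Sum>j<n. c j * e j x) * cnj (\<Sum>k<n. d k * e k x)) \<le> (\<Sum>j. norm (c j) * E j) * (\<Sum>j. norm (d j) * E j)"
      unfolding norm_mult complex_mod_cnj
      by (intro mult_mono Uf(3) Ug(3) x norm_ge_zero order_trans[OF norm_ge_zero Uf(3)[OF x]])
  next
    fix x assume x: "x \<in> {a..b}"
    show "(\<lambda>n. (\<Sum>j<n. c j * e j x) * cnj (\<Sum>k<n. d k * e k x)) \<longlonglongrightarrow> f x * cnj (g x)"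
      using Uf(2)[OF x] Ug(2)[OF x] unfolding sums_def by (intro tendsto_intros)
  qed
  then show ?thesis
    unfolding LBINT_open_interval_continuous[OF cfg, unfolded f_def g_def] sums_def f_def g_def
    unfolding integral_unique[OF int] .
qed

section \<open>Convergence and continuity of the overlap\<close>

text \<open>Each monomial of the Ito polynomial has degree \<open>(j - i) + (m - i)\<close>, so it is at most \<open>s^(j + 2 (m - i)) / s^m\<close> in modulus
with \<open>s = sqrt a \<le> 1\<close>. Against the prefactor \<open>q^(- m j / 2)\<close> this leaves the ratio \<open>r = sqrt (a / q^m) < 1\<close>.
Uniformity in \<open>z\<close> is needed for the continuity of the overlap.\<close>

lemma h_coeff_bound:
  assumes q: "0 < q" "q < 1" and a: "0 < a" "a < q ^ m"
  obtains K r where "0 \<le> K" "0 \<le> r" "r < 1"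
    "\<And>j z. (1 - q) * (cmod z)\<^sup>2 \<le> a \<Longrightarrow> norm (h_coeff m q j z) \<le> K * r ^ j"
proof -
  define Q where "Q = complex_of_real q"
  have Q: "norm Q < 1" using q by (simp add: Q_def)
  obtain B where B: "B > 0" "\<And>n. norm (1 / qpoch Q Q n) \<le> B" using bounded_inverse_qpoch[OF Q] by blast
  have qm: "0 < q ^ m" "q ^ m \<le> 1" using q by (auto intro: power_le_one)
  define s where "s = sqrt a"
  have s: "0 < s" "s \<le> 1" using a qm by (auto simp: s_def)
  define r where "r = s / sqrt (q ^ m)"
  have r: "0 \<le> r" "r < 1" using a qm by (auto simp: r_def s_def real_sqrt_less_mono)
  define K where "K = (real m + 1) * (B * B * B) / s ^ m"
  have K: "0 \<le> K" using B(1) s by (simp add: K_def)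
  have "norm (h_coeff m q j z) \<le> K * r ^ j" if z: "(1 - q) * (cmod z)\<^sup>2 \<le> a" for j z
  proof -
    define t where "t = complex_of_real (sqrt (1 - q)) * z"
    have t: "norm t \<le> s"
    proof -
      have "norm t = sqrt ((1 - q) * (cmod z)\<^sup>2)" using q by (simp add: t_def norm_mult real_sqrt_mult)
      then show ?thesis using z by (simp add: s_def)
    qed
    have "norm (ito_poly Q m j t (cnj t)) \<le> (\<Sum>i\<le>min m j. B * B * B * (s ^ j / s ^ m))"
      unfolding ito_poly_def
    proof (rule sum_norm_le)
      fix i assume i: "i \<in> {..min m j}"
      have "norm ((-1) ^ i * Q ^ (i choose 2) / (qpoch Q Q i * qpoch Q Q (m - i) * qpoch Q Q (j - i)) * t ^ (j - i) * cnj t ^ (m - i))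
        = norm Q ^ (i choose 2) * (norm (1 / qpoch Q Q i) * norm (1 / qpoch Q Q (m - i)) * norm (1 / qpoch Q Q (j - i))) * (norm t ^ (j - i) * norm t ^ (m - i))"
        by (simp add: norm_mult norm_divide norm_power)
      also have "\<dots> \<le> 1 * (B * B * B) * (s ^ j / s ^ m)"
      proof (intro mult_mono B)
        show "norm Q ^ (i choose 2) \<le> 1" using Q by (intro power_le_one) auto
        have "norm t ^ (j - i) * norm t ^ (m - i) \<le> s ^ (j - i) * s ^ (m - i)"
          using t s by (intro mult_mono power_mono) auto
        also have "\<dots> \<le> s ^ j / s ^ m"
        proof -
          have "s ^ (j - i) * s ^ (m - i) * s ^ m = s ^ (j + 2 * (m - i))"
          proof -
            have "j - i + (m - i) + m = j + 2 * (m - i)" using i by (simp, arith)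
            then show ?thesis by (simp only: power_add[symmetric])
          qed
          also have "\<dots> \<le> s ^ j" using s by (intro power_decreasing) auto
          finally show ?thesis using s by (simp add: pos_le_divide_eq)
        qed
        finally show "norm t ^ (j - i) * norm t ^ (m - i) \<le> s ^ j / s ^ m" .
      qed (use B(1) s in \<open>auto intro!: mult_nonneg_nonneg less_imp_le\<close>)
      finally show "norm ((-1) ^ i * Q ^ (i choose 2) / (qpoch Q Q i * qpoch Q Q (m - i) * qpoch Q Q (j - i)) * t ^ (j - i) * cnj t ^ (m - i))
         \<le> B * B * B * (s ^ j / s ^ m)" by simp
    qed
    also have "\<dots> = (real (min m j) + 1) * (B * B * B * (s ^ j / s ^ m))" by simp
    also have "\<dots> \<le> (real m + 1) * (B * B * B * (s ^ j / s ^ m))"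
      using B(1) s by (intro mult_right_mono) auto
    also have "\<dots> = K * s ^ j" by (simp add: K_def)
    finally have ito: "norm (ito_poly Q m j t (cnj t)) \<le> K * s ^ j" .
    have pre: "sqrt (qpoch q q m * qpoch q q j / q ^ (m * j)) \<le> 1 / sqrt (q ^ m) ^ j"
    proof -
      have "qpoch q q m * qpoch q q j \<le> 1 * 1"
        using qpoch_le_1[OF q] qpoch_pos[OF q] by (intro mult_mono) (auto intro: less_imp_le)
      then have "sqrt (qpoch q q m * qpoch q q j / q ^ (m * j)) \<le> sqrt (1 / q ^ (m * j))"
        using q by (intro real_sqrt_le_mono divide_right_mono) auto
      then show ?thesis by (simp add: real_sqrt_divide real_sqrt_power power_mult)
    qed
    have "norm (h_coeff m q j z) = sqrt (qpoch q q m * qpoch q q j / q ^ (m * j)) * norm (ito_poly Q m j t (cnj t))"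
      unfolding h_coeff_eq_ito_poly[OF q] using qpoch_pos[OF q, of m] qpoch_pos[OF q, of j] q
      by (simp add: norm_mult t_def Q_def)
    also have "\<dots> \<le> 1 / sqrt (q ^ m) ^ j * (K * s ^ j)"
      using pre ito qm by (intro mult_mono) auto
    also have "\<dots> = K * r ^ j" by (simp add: r_def power_divide)
    finally show ?thesis .
  qed
  with K r show ?thesis using that by blast
qed

lemma continuous_on_h_coeff:
  assumes q: "0 < q" "q < 1"
  shows "continuous_on UNIV (h_coeff m q j)"
  unfolding h_coeff_eq_ito_poly[OF q, abs_def] ito_poly_def by (intro continuous_intros)

lemma coherent_domain_margin:
  assumes "z \<in> coherent_domain q m" "0 < q" "q < 1"
  obtains a where "0 < a" "a < q ^ m" "(1 - q) * (cmod z)\<^sup>2 < a"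
proof -
  have "(1 - q) * (cmod z)\<^sup>2 < q ^ m" using assms by (simp add: coherent_domain_def)
  then obtain a where a: "(1 - q) * (cmod z)\<^sup>2 < a" "a < q ^ m" using dense by blast
  moreover have "0 \<le> (1 - q) * (cmod z)\<^sup>2" using assms by simp
  ultimately show ?thesis using that by force
qed

lemma summable_h_coeff_q_fun_bound:
  assumes q: "0 < q" "q < 1" and z: "z \<in> coherent_domain q m"
  shows "summable (\<lambda>j. norm (h_coeff m q j z) * (C * (real j + 1)))"
proof -
  obtain a where a: "0 < a" "a < q ^ m" "(1 - q) * (cmod z)\<^sup>2 < a" using coherent_domain_margin[OF z q] by blast
  obtain K r where K: "0 \<le> K" "0 \<le> r" "r < 1"
    "\<And>j z. (1 - q) * (cmod z)\<^sup>2 \<le> a \<Longrightarrow> norm (h_coeff m q j z) \<le> K * r ^ j"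
    using h_coeff_bound[OF q a(1,2)] by blast
  have "summable (\<lambda>j. (of_nat (Suc j) * r ^ j) * (K * \<bar>C\<bar>))"
    using geometric_deriv_sums[of r] K by (intro summable_mult2 sums_summable) auto
  then show ?thesis
  proof (rule summable_comparison_test[rotated], intro exI allI impI)
    fix j
    have "norm (norm (h_coeff m q j z) * (C * (real j + 1))) = norm (h_coeff m q j z) * (\<bar>C\<bar> * (real j + 1))"
      by (simp add: abs_mult)
    also have "\<dots> \<le> K * r ^ j * (\<bar>C\<bar> * (real j + 1))"
      using K(4)[of z j] a by (intro mult_right_mono) auto
    finally show "norm (norm (h_coeff m q j z) * (C * (real j + 1))) \<le> of_nat (Suc j) * r ^ j * (K * \<bar>C\<bar>)"
      by (simp add: algebra_simps)
  qed
qed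

lemma coherent_state_has_L2_sum:
  assumes q: "0 < q" "q < 1" and z: "z \<in> coherent_domain q m"
  shows "has_L2_sum (q_interval q) (\<lambda>j \<xi>. cnj (h_coeff m q j z) * q_fun q j \<xi>) (coherent_state m q z)"
proof -
  obtain C where C: "C \<ge> 0" "\<And>j \<xi>. \<xi> \<in> {- half_width q..half_width q} \<Longrightarrow> norm (q_fun q j \<xi>) \<le> C * (real j + 1)"
    using norm_q_fun_le[OF q] by blast
  show ?thesis unfolding q_interval_eq coherent_state_def[abs_def]
  proof (rule has_L2_sum_dominated)
    show "summable (\<lambda>j. norm (h_coeff m q j z) * (C * (real j + 1)))" by (rule summable_h_coeff_q_fun_bound[OF q z])
    show "continuous_on {- half_width q..half_width q} (\<lambda>\<xi>. cnj (h_coeff m q j z) * q_fun q j \<xi>)" for j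
      by (intro continuous_intros continuous_on_q_fun q)
    show "norm (cnj (h_coeff m q j z) * q_fun q j x) \<le> norm (h_coeff m q j z) * (C * (real j + 1))"
      if "x \<in> {- half_width q..half_width q}" for j x
      using C(2)[OF that, of j] by (simp add: norm_mult mult_left_mono)
  qed
qed

lemma overlap_sums:
  assumes q: "0 < q" "q < 1" and z: "z \<in> coherent_domain q m" and w: "w \<in> coherent_domain q m"
  shows "(\<lambda>j. cnj (h_coeff m q j z) * h_coeff m q j w) sums overlap m q z w"
proof -
  obtain C where C: "C \<ge> 0" "\<And>j \<xi>. \<xi> \<in> {- half_width q..half_width q} \<Longrightarrow> norm (q_fun q j \<xi>) \<le> C * (real j + 1)"
    using norm_q_fun_le[OF q] by blast
  have "(\<lambda>j. cnj (h_coeff m q j z) * cnj (cnj (h_coeff m q j w))) sums overlap m q z w"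
    unfolding overlap_def coherent_state_def q_interval_eq
    by (rule inner_product_sums[where E = "\<lambda>j. C * (real j + 1)"])
       (use C(2) summable_h_coeff_q_fun_bound[OF q z] summable_h_coeff_q_fun_bound[OF q w] in
         \<open>simp_all add: continuous_on_q_fun[OF q] q_fun_orthonormal[OF q]\<close>)
  then show ?thesis by simp
qed

text \<open>Near \<open>(z, w)\<close> the series of \<open>overlap_sums\<close> is dominated by a geometric series, and its terms are continuous.\<close>

lemma overlap_tendsto:
  assumes q: "0 < q" "q < 1" and z: "z \<in> coherent_domain q m" and w: "w \<in> coherent_domain q m"
  shows "((\<lambda>(z', w'). overlap m q z' w') \<longlongrightarrow> overlap m q z w) (at (z, w))"
proof -
  obtain a where a: "0 < a" "a < q ^ m" "(1 - q) * (cmod z)\<^sup>2 < a" using coherent_domain_margin[OF z q] by blast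
  obtain b where b: "0 < b" "b < q ^ m" "(1 - q) * (cmod w)\<^sup>2 < b" using coherent_domain_margin[OF w q] by blast
  obtain K r where K: "0 \<le> K" "0 \<le> r" "r < 1"
    "\<And>j z. (1 - q) * (cmod z)\<^sup>2 \<le> a \<Longrightarrow> norm (h_coeff m q j z) \<le> K * r ^ j"
    using h_coeff_bound[OF q a(1,2)] by blast
  obtain L s where L: "0 \<le> L" "0 \<le> s" "s < 1"
    "\<And>j z. (1 - q) * (cmod z)\<^sup>2 \<le> b \<Longrightarrow> norm (h_coeff m q j z) \<le> L * s ^ j"
    using h_coeff_bound[OF q b(1,2)] by blast
  define U where "U = {z'. (1 - q) * (cmod z')\<^sup>2 < a} \<times> {w'. (1 - q) * (cmod w')\<^sup>2 < b}"
  have U: "open U" "(z, w) \<in> U" unfolding U_def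
    using a b by (auto intro!: open_Times open_Collect_less continuous_intros)
  define f where "f j p = cnj (h_coeff m q j (fst p)) * h_coeff m q j (snd p)" for j p
  have "r * s \<le> 1 * s" using K L by (intro mult_right_mono) auto
  then have rs: "norm (r * s) < 1" using K L by (simp add: abs_mult)
  have "continuous_on U (\<lambda>p. \<Sum>j. f j p)"
  proof (rule dominated_series(1))
    show "continuous_on U (f j)" for j unfolding f_def
      by (intro continuous_intros continuous_on_compose2[OF continuous_on_h_coeff[OF q]]) auto
    show "summable (\<lambda>j. (K * L) * (r * s) ^ j)" using rs by (intro summable_mult summable_geometric)
    show "norm (f j p) \<le> (K * L) * (r * s) ^ j" if "p \<in> U" for j p
    proof -
      have "norm (f j p) \<le> (K * r ^ j) * (L * s ^ j)"
        unfolding f_def norm_mult complex_mod_cnj using that K L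
        by (intro mult_mono K(4) L(4)) (auto simp: U_def)
      then show ?thesis by (simp add: power_mult_distrib mult_ac)
    qed
  qed
  also have "?this \<longleftrightarrow> continuous_on U (\<lambda>(z', w'). overlap m q z' w')"
  proof (intro continuous_on_cong refl)
    fix p assume "p \<in> U"
    then have "fst p \<in> coherent_domain q m" "snd p \<in> coherent_domain q m"
      using a b by (auto simp: U_def coherent_domain_def)
    from sums_unique[OF overlap_sums[OF q this]]
    show "(\<Sum>j. f j p) = (case p of (z', w') \<Rightarrow> overlap m q z' w')"
      by (simp add: f_def case_prod_beta)
  qed
  finally have "isCont (\<lambda>(z', w'). overlap m q z' w') (z, w)"
    using U by (simp add: continuous_on_eq_continuous_at)
  then show ?thesis by (simp add: isCont_def)
qed

theorem proposition1p2:
  fixes m :: nat and q :: real and z w :: complex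
  assumes "0 < q" and "q < 1"
    and "z \<in> coherent_domain q m" and "w \<in> coherent_domain q m"
  shows "has_L2_sum (q_interval q) (\<lambda>j \<xi>. cnj (h_coeff m q j z) * q_fun q j \<xi>) (coherent_state m q z)
    \<and> (\<lambda>j. cnj (h_coeff m q j z) * h_coeff m q j w) sums overlap m q z w
    \<and> ((z, w) \<in> regular_pairs m q \<longrightarrow> overlap m q z w = overlap_formula m q z w)
    \<and> ((z, w) \<notin> regular_pairs m q \<longrightarrow>
         ((\<lambda>(z', w'). overlap_formula m q z' w') \<longlongrightarrow> overlap m q z w)
           (at (z, w) within regular_pairs m q))"
proof -
  have formula: "overlap m q z' w' = overlap_formula m q z' w'" if r: "(z', w') \<in> regular_pairs m q" for z' w'
  proof -
    have "z' \<in> coherent_domain q m" "w' \<in> coherent_domain q m" using r by (auto simp: regular_pairs_def)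
    then show ?thesis
      using sums_unique2[OF overlap_sums[OF assms(1,2)] h_coeff_products_sum_to_overlap_formula[OF assms(1,2) r]] by blast
  qed
  have "((\<lambda>(z', w'). overlap m q z' w') \<longlongrightarrow> overlap m q z w) (at (z, w) within regular_pairs m q)"
    by (rule tendsto_within_subset[OF overlap_tendsto[OF assms]]) simp
  then have "((\<lambda>(z', w'). overlap_formula m q z' w') \<longlongrightarrow> overlap m q z w) (at (z, w) within regular_pairs m q)"
  proof (rule Lim_transform_eventually)
    show "\<forall>\<^sub>F p in at (z, w) within regular_pairs m q. (case p of (z', w') \<Rightarrow> overlap m q z' w') = (case p of (z', w') \<Rightarrow> overlap_formula m q z' w')"
      unfolding eventually_at_filter by (rule always_eventually) (auto simp: formula)
  qed
  then show ?thesis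
    using coherent_state_has_L2_sum[OF assms(1-3)] overlap_sums[OF assms] formula by blast
qed

end
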